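(* Let $d\ge 1$ and let $\mathcal{H}$ be a complex Hilbert space of dimension $d$. Let $\mathcal{E}=\{\rho_x\}$ be any discrete or continuous rank-one ensemble on $\mathcal{H}$, with average state $\rho$, and let $\mathcal{P}=\{\Pi_y\}$ be any discrete or continuous rank-one POVM on $\mathcal{H}$. Then the accessible information $A(\mathcal{E})$ and the informational power $W(\mathcal{P})$ satisfy $$0\le A(\mathcal{E})\le \log d \qquad (1)$$ and $$\log d-\frac{1}{\ln 2}\sum_{n=2}^{d}\frac1n\;\le\; W(\mathcal{P})\;\le\;\log d. \qquad (2)$$ Moreover: the lower bound in (1) is attained with equality when $\rho_x\propto\rho$ for all $x$; the upper bound in (1) is attained with equality when $\rho_x=\frac1d |e_x\rangle\langle e_x|$ for some orthonormal basis $\{|e_x\rangle\}_{x=1}^d$ of $\mathcal{H}$; the lower bound in (2) is attained with equality when $\mathcal{P}$ is the Scrooge POVM; and the upper bound in (2) is attained with equality when $\Pi_y=|e_y\rangle\langle e_y|$ for some orthonormal basis $\{|e_y\rangle\}_{y=1}^d$ of $\mathcal{H}$.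
   Context: $\log$ is the base-2 logarithm, $\ln$ the natural logarithm. All Hilbert spaces are finite-dimensional and complex. A state is a positive semidefinite operator $\rho$ with $\operatorname{Tr}\rho\le 1$. A discrete ensemble is a family $\mathcal{E}=\{\rho_x\}$ of states indexed by a countable set of real numbers with $\sum_x\operatorname{Tr}[\rho_x]=1$; a continuous ensemble is a measurable operator-valued function $x\mapsto\rho_x$, from a measurable set of real numbers to states, with $\int dx\,\operatorname{Tr}[\rho_x]=1$. Its average state is $\rho=\sum_x\rho_x$ (resp. $\int dx\,\rho_x$). An effect is an operator $\Pi$ with $0\le\Pi\le \mathbb{1}$. A discrete POVM is a family $\mathcal{P}=\{\Pi_y\}$ of effects indexed by a countable set of real numbers with $\sum_y\Pi_y=\mathbb{1}$; a continuous POVM is a measurable function $y\mapsto\Pi_y$, from a measurable set of real numbers to effects, with $\int dy\,\Pi_y=\mathbb{1}$. An ensemble (resp. POVM) is rank-one if every $\rho_x$ (resp. every $\Pi_y$) has rank one. Given $\mathcal{E}$ and $\mathcal{P}$ on the same space, the joint distribution (density) of random variables $X,Y$ is $p(x,y)=\operatorname{Tr}[\rho_x\Pi_y]$, with marginals $p(x)=\operatorname{Tr}[\rho_x]$ and $p(y)=\operatorname{Tr}[\rho\,\Pi_y]$. The mutual information is $$I(\mathcal{E},\mathcal{P})=I(X;Y)=\sum_{x,y}p(x,y)\log\frac{p(x,y)}{p(x)p(y)},$$ with sums replaced by integrals for continuous indices (terms with $p(x,y)=0$ count as $0$); it equals $H(X)+H(Y)-H(X,Y)$ whenever these (Shannon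 or differential) entropies are well defined and finite. Accessible information: $A(\mathcal{E})=\sup_{\mathcal{P}}I(\mathcal{E},\mathcal{P})$, the supremum being over all discrete or continuous POVMs on $\mathcal{H}$. Informational power: $W(\mathcal{P})=\sup_{\mathcal{E}}I(\mathcal{E},\mathcal{P})$, the supremum being over all discrete or continuous ensembles on $\mathcal{H}$. Scrooge POVM: the continuous rank-one POVM uniformly distributed according to the Haar measure, i.e. the POVM with "density" $d\,|\psi\rangle\langle\psi|\,d\mu(\psi)$, where $\mu$ is the unitarily invariant probability measure on unit vectors of $\mathcal{H}$. With a real index it can be written $\Pi_y=|\psi_y\rangle\langle\psi_y|$, $y\in[0,d]$, where $y\mapsto\psi_y$ is a measurable map to unit vectors pushing the normalized Lebesgue measure $dy/d$ on $[0,d]$ forward to $\mu$. *)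

theory Defs
  imports "HOL-Probability.Probability"
begin

text \<open>
  The Hilbert space of dimension \<open>d\<close> is \<open>complex ^ 'n\<close> with \<open>d = CARD('n)\<close>; operators on it are
  matrices \<open>complex ^ 'n ^ 'n\<close>.
\<close>

type_synonym 'n operator = "complex ^ 'n ^ 'n"

definition cinner :: "complex ^ 'n::finite \<Rightarrow> complex ^ 'n \<Rightarrow> complex" where
  "cinner v w = (\<Sum>i\<in>UNIV. cnj (v $ i) * w $ i)"

definition ketbra :: "complex ^ 'n::finite \<Rightarrow> 'n operator" where
  "ketbra v = (\<chi> i j. v $ i * cnj (v $ j))"

text \<open>Over the complex numbers the condition below already forces \<open>A\<close> to be Hermitian.\<close>

definition psd :: "'n::finite operator \<Rightarrow> bool" where
  "psd A \<longleftrightarrow> (\<forall>v. cinner v (A *v v) \<in> \<real>\<^sub>\<ge>\<^sub>0)"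

definition state :: "'n::finite operator \<Rightarrow> bool" where
  "state \<rho> \<longleftrightarrow> psd \<rho> \<and> Re (trace \<rho>) \<le> 1"

definition effect :: "'n::finite operator \<Rightarrow> bool" where
  "effect P \<longleftrightarrow> psd P \<and> psd (mat 1 - P)"

text \<open>
  Discrete and continuous families are treated uniformly: the index set carries counting measure
  in the discrete case and Lebesgue measure in the continuous case, and sums and integrals over
  the index are both integrals with respect to that measure. A family is a pair of such a measure
  and a function, whose values outside the space of the measure are irrelevant.
\<close>

definition discrete_index :: "real measure \<Rightarrow> bool" where
  "discrete_index M \<longleftrightarrow> (\<exists>X. countable X \<and> M = count_space X)"

definition continuous_index :: "real measure \<Rightarrow> bool" where
  "continuous_index M \<longleftrightarrow> (\<exists>X\<in>sets lebesgue. M = lebesgue_on X)"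

definition ensemble :: "real measure \<Rightarrow> (real \<Rightarrow> 'n::finite operator) \<Rightarrow> bool" where
  "ensemble M \<rho> \<longleftrightarrow>
     (discrete_index M \<or> continuous_index M) \<and>
     \<rho> \<in> borel_measurable M \<and>
     (\<forall>x\<in>space M. state (\<rho> x)) \<and>
     has_bochner_integral M (\<lambda>x. trace (\<rho> x)) 1"

definition povm :: "real measure \<Rightarrow> (real \<Rightarrow> 'n::finite operator) \<Rightarrow> bool" where
  "povm N P \<longleftrightarrow>
     (discrete_index N \<or> continuous_index N) \<and>
     P \<in> borel_measurable N \<and>
     (\<forall>y\<in>space N. effect (P y)) \<and>
     has_bochner_integral N P (mat 1)"

definition rank_one :: "real measure \<Rightarrow> (real \<Rightarrow> 'n::finite operator) \<Rightarrow> bool" where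
  "rank_one M A \<longleftrightarrow> (\<forall>x\<in>space M. rank (A x) = 1)"

definition average_state :: "real measure \<Rightarrow> (real \<Rightarrow> 'n::finite operator) \<Rightarrow> 'n operator" where
  "average_state M \<rho> = (\<integral>x. \<rho> x \<partial>M)"

definition joint_prob ::
  "(real \<Rightarrow> 'n::finite operator) \<Rightarrow> (real \<Rightarrow> 'n operator) \<Rightarrow> real \<Rightarrow> real \<Rightarrow> real" where
  "joint_prob \<rho> P x y = Re (trace (\<rho> x ** P y))"

definition input_prob :: "(real \<Rightarrow> 'n::finite operator) \<Rightarrow> real \<Rightarrow> real" where
  "input_prob \<rho> x = Re (trace (\<rho> x))"

definition output_prob ::
  "real measure \<Rightarrow> (real \<Rightarrow> 'n::finite operator) \<Rightarrow> (real \<Rightarrow> 'n operator) \<Rightarrow> real \<Rightarrow> real" where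
  "output_prob M \<rho> P y = Re (trace (average_state M \<rho> ** P y))"

text \<open>
  Terms with \<open>joint_prob \<rho> P x y = 0\<close> vanish because of the outer factor.
\<close>

definition info_term ::
  "real measure \<Rightarrow> (real \<Rightarrow> 'n::finite operator) \<Rightarrow> (real \<Rightarrow> 'n operator) \<Rightarrow> real \<Rightarrow> real \<Rightarrow> real"
where
  "info_term M \<rho> P x y =
     joint_prob \<rho> P x y *
       log 2 (joint_prob \<rho> P x y / (input_prob \<rho> x * output_prob M \<rho> P y))"

text \<open>
  The mutual information is the integral of \<open>info_term\<close>, as the difference of the integrals of its
  positive and negative parts in the extended reals. A divergent positive part thus gives
  \<open>\<infinity>\<close> rather than the value \<open>0\<close> of the Bochner integral of a non-integrable function.
\<close>

definition mutual_info ::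
  "real measure \<Rightarrow> (real \<Rightarrow> 'n::finite operator) \<Rightarrow> real measure \<Rightarrow> (real \<Rightarrow> 'n operator) \<Rightarrow> ereal"
where
  "mutual_info M \<rho> N P =
     enn2ereal (\<integral>\<^sup>+ (x, y). ennreal (info_term M \<rho> P x y) \<partial>(M \<Otimes>\<^sub>M N)) -
     enn2ereal (\<integral>\<^sup>+ (x, y). ennreal (- info_term M \<rho> P x y) \<partial>(M \<Otimes>\<^sub>M N))"

definition accessible_information ::
  "real measure \<Rightarrow> (real \<Rightarrow> 'n::finite operator) \<Rightarrow> ereal" where
  "accessible_information M \<rho> = (SUP (N, P) \<in> {(N, P). povm N P}. mutual_info M \<rho> N P)"

definition informational_power ::
  "real measure \<Rightarrow> (real \<Rightarrow> 'n::finite operator) \<Rightarrow> ereal" where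
  "informational_power N P = (SUP (M, \<rho>) \<in> {(M, \<rho>). ensemble M \<rho>}. mutual_info M \<rho> N P)"

definition orthonormal_basis :: "real set \<Rightarrow> (real \<Rightarrow> complex ^ 'n::finite) \<Rightarrow> bool" where
  "orthonormal_basis I e \<longleftrightarrow>
     (\<forall>i\<in>I. \<forall>j\<in>I. cinner (e i) (e j) = (if i = j then 1 else 0)) \<and>
     vec.span (e ` I) = UNIV"

definition conj_transpose :: "'n::finite operator \<Rightarrow> 'n operator" where
  "conj_transpose U = (\<chi> i j. cnj (U $ j $ i))"

definition unitary :: "'n::finite operator \<Rightarrow> bool" where
  "unitary U \<longleftrightarrow> conj_transpose U ** U = mat 1 \<and> U ** conj_transpose U = mat 1"

definition unit_vectors :: "(complex ^ 'n::finite) measure" where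
  "unit_vectors = restrict_space borel (sphere 0 1)"

text \<open>
  The measure on unit vectors singled out here is unique, so the predicate determines it.
\<close>

definition haar_on_unit_vectors :: "(complex ^ 'n::finite) measure \<Rightarrow> bool" where
  "haar_on_unit_vectors \<mu> \<longleftrightarrow>
     prob_space \<mu> \<and> sets \<mu> = sets unit_vectors \<and>
     (\<forall>U. unitary U \<longrightarrow> distr \<mu> unit_vectors (\<lambda>v. U *v v) = \<mu>)"

definition scrooge_povm :: "real measure \<Rightarrow> (real \<Rightarrow> 'n::finite operator) \<Rightarrow> bool" where
  "scrooge_povm N P \<longleftrightarrow>
     N = lebesgue_on {0..real CARD('n)} \<and>
     (\<exists>\<psi> \<in> measurable N unit_vectors.
        haar_on_unit_vectors (distr (scale_measure (ennreal (1 / real CARD('n))) N) unit_vectors \<psi>) \<and>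
        (\<forall>y\<in>space N. P y = ketbra (\<psi> y)))"

end

theory Submission
  imports Defs
begin

text \<open>
  Write \<open>p(x,y)\<close>, \<open>a(x)\<close>, \<open>q(y)\<close> for the joint and marginal densities, \<open>t(y)\<close> for the trace of the
  effect at \<open>y\<close>, and \<open>h\<close> for the sum of \<open>1/n\<close> over \<open>2 \<le> n \<le> d\<close>. Everything is measured in nats.
  Nonnegativity is \<open>p ln (p/(aq)) \<ge> p - aq\<close>. Since \<open>p \<le> a t\<close>, the integrand is at most
  \<open>p ln (t/q) \<le> p ln d + p (t/(qd) - 1)\<close>, whose integral is at most \<open>ln d\<close>.

  The constant \<open>h\<close> is the Gaussian average of \<open>X ln (S/X)\<close>, where \<open>S = |z|^2\<close> and \<open>X = |\<langle>v,z\<rangle>|^2\<close> for a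
  unit vector \<open>v\<close>: \<open>X\<close> is exponentially and \<open>S\<close> is Erlang distributed, and by symmetry \<open>X\<close> may be
  replaced by \<open>S/d\<close> in front of \<open>ln S\<close>. Fubini and unitary invariance transfer this value to every
  Haar measure on the unit sphere. For the Scrooge POVM the log sum inequality, applied to
  decompositions of the states into rank-one operators, shows that at least \<open>h\<close> is lost from the
  bound \<open>ln d\<close>. For an arbitrary rank-one POVM, the finite ensembles consisting of the signed
  permutations of a Gaussian vector have average state \<open>1/d\<close> and lose exactly \<open>h\<close> on average.
\<close>

section \<open>Positive semidefinite operators\<close>

text \<open>The two lower estimates for the informational power rest on one identity: p ln (t/q)
  exceeds p ln (p/(aq)) by p ln (at/p), which no longer involves the average state. This deficit is
  nonnegative, so Tonelli applies to it before integrability is known, and it is homogeneous of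
  degree one, so unnormalised vectors may be used. That is why a Gaussian can stand in for a surface
  measure on the sphere: the radius factors out of the average. The Haar distributed ensemble, the
  natural candidate for the lower bound, would have to be indexed by a real variable, which calls
  for a measurable parametrisation of the sphere. Since the informational power is a supremum, one
  number bounds the information of all finite ensembles at once, and the resulting inequalities
  between deficits can be averaged over the vector that generates the ensemble. The harmonic sum is
  a difference of digamma values: the mean of X ln X for a Gamma variable of shape k is k
  digamma(k+1), so h = digamma(d+1) - digamma(2).\<close>

lemma cinner_add_left: "cinner (u + v) w = cinner u w + cinner v w"
  by (simp add: cinner_def sum.distrib algebra_simps)

lemma cinner_add_right: "cinner w (u + v) = cinner w u + cinner w v"
  by (simp add: cinner_def sum.distrib algebra_simps)

lemma cinner_scale_left: "cinner (c *s u) w = cnj c * cinner u w"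
  by (simp add: cinner_def sum_distrib_left algebra_simps)

lemma cinner_scale_right: "cinner w (c *s u) = c * cinner w u"
  by (simp add: cinner_def sum_distrib_left algebra_simps)

lemma cinner_commute: "cinner v u = cnj (cinner u v)"
  by (simp add: cinner_def mult.commute)

lemma cinner_axis_left: "cinner (axis i 1) v = v $ i"
  by (simp add: cinner_def axis_def if_distrib if_distribR cong: if_cong)

lemma cinner_self: "cinner v v = of_real ((norm v)\<^sup>2)"
proof -
  have "(norm v)\<^sup>2 = (\<Sum>i\<in>UNIV. (cmod (v $ i))\<^sup>2)"
    by (simp add: norm_vec_def L2_set_def real_sqrt_pow2 sum_nonneg)
  then show ?thesis
    by (simp add: cinner_def complex_norm_square mult.commute del: of_real_power)
qed

lemma cmod_cinner_le: "cmod (cinner v w) \<le> norm v * norm w"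
proof -
  have "cmod (cinner v w) \<le> (\<Sum>i\<in>UNIV. \<bar>cmod (v $ i)\<bar> * \<bar>cmod (w $ i)\<bar>)"
    unfolding cinner_def by (rule order_trans[OF norm_sum]) (simp add: norm_mult)
  also have "\<dots> \<le> norm v * norm w"
    unfolding norm_vec_def by (rule L2_set_mult_ineq)
  finally show ?thesis .
qed

lemma cmod_cinner_commute: "cmod (cinner v w) = cmod (cinner w v)"
  by (subst cinner_commute) simp

lemma matrix_vector_mult_axis: "(A *v axis j (1::complex)) $ k = A $ k $ j"
  by (simp add: matrix_vector_mult_def axis_def if_distrib cong: if_cong)

text \<open>The form evaluated at \<open>u + c *s axis i 1\<close>. The two cross terms are kept
  apart because Hermitian symmetry is only derived from this formula. Suitable \<open>u\<close> and
  \<open>c\<close> then also give \<open>psd_entry_0\<close> and the Schur step.\<close>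

lemma psd_form:
  assumes "psd A"
  shows "cinner u (A *v u) + c * cinner u (A *v axis i 1) + cnj c * (A *v u) $ i
           + c * cnj c * A $ i $ i \<in> \<real>\<^sub>\<ge>\<^sub>0"
proof -
  have "cinner (u + c *s axis i 1) (A *v (u + c *s axis i 1)) \<in> \<real>\<^sub>\<ge>\<^sub>0"
    using assms by (simp add: psd_def)
  then show ?thesis
    by (simp add: cinner_add_left cinner_add_right cinner_scale_left cinner_scale_right
        matrix_vector_right_distrib matrix_vector_mult_scaleR vector_scalar_commute
        cinner_axis_left matrix_vector_mult_axis algebra_simps)
qed

lemma psd_diag: "psd A \<Longrightarrow> A $ i $ i \<in> \<real>\<^sub>\<ge>\<^sub>0"
  unfolding psd_def by (metis cinner_axis_left matrix_vector_mult_axis)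

lemma psd_hermitian:
  assumes "psd A"
  shows "A $ i $ j = cnj (A $ j $ i)"
proof (cases "i = j")
  case True
  then show ?thesis using psd_diag[OF assms, of i]
    by (auto simp: complex_eq_iff complex_nonneg_Reals_iff)
next
  case False
  have q: "A $ i $ i + c * A $ i $ j + cnj c * A $ j $ i + c * cnj c * A $ j $ j \<in> \<real>\<^sub>\<ge>\<^sub>0" for c
    using psd_form[OF assms, of "axis i 1" c j] by (simp add: cinner_axis_left matrix_vector_mult_axis)
  show ?thesis
    \<comment> \<open>Imaginary parts: c = 1 gives opposite imaginary parts of the two entries, c =
      i gives equal real parts.\<close>
    using q[of 1] q[of \<i>] psd_diag[OF assms, of i] psd_diag[OF assms, of j]
    by (auto simp: complex_eq_iff complex_nonneg_Reals_iff)
qed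

lemma psd_cinner_axis: "psd A \<Longrightarrow> cinner u (A *v axis i 1) = cnj ((A *v u) $ i)"
proof -
  assume "psd A"
  then have "A $ k $ i = cnj (A $ i $ k)" for k by (rule psd_hermitian)
  then have "(\<Sum>k\<in>UNIV. cnj (u $ k) * A $ k $ i) = (\<Sum>k\<in>UNIV. cnj (A $ i $ k) * cnj (u $ k))"
    by (intro sum.cong) (simp_all add: mult.commute)
  then show ?thesis
    by (simp add: cinner_def matrix_vector_mult_axis) (simp add: matrix_vector_mult_def)
qed

text \<open>With a zero diagonal entry the quadratic term in \<open>c\<close> disappears, and a
  nonconstant affine expression cannot stay nonnegative.\<close>

lemma psd_entry_0:
  assumes "psd A" "A $ j $ j = 0"
  shows "A $ i $ j = 0"
proof -
  let ?b = "A $ i $ j"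
  define r where "r = Re (A $ i $ i)"
  have h: "A $ j $ i = cnj ?b" by (rule psd_hermitian[OF assms(1)])
  have q: "A $ i $ i + c * ?b + cnj c * cnj ?b \<in> \<real>\<^sub>\<ge>\<^sub>0" for c
    using psd_form[OF assms(1), of "axis i 1" c j] assms(2) h
    by (simp add: cinner_axis_left matrix_vector_mult_axis)
  have r: "r - 2 * t * (cmod ?b)\<^sup>2 \<ge> 0" for t :: real
    using q[of "- of_real t * cnj ?b"]
    unfolding cmod_power2 by (simp add: r_def complex_nonneg_Reals_iff power2_eq_square mult.assoc)
  show ?thesis
  proof (rule ccontr)
    assume "?b \<noteq> 0"
    then show False
      \<comment> \<open>This choice of t makes the left side of \<open>r\<close> equal to
        -1.\<close>
      using r[of "(r + 1) / (2 * (cmod ?b)\<^sup>2)"] by simp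
  qed
qed

lemma cinner_ketbra: "cinner u (ketbra v *v u) = of_real ((cmod (cinner v u))\<^sup>2)"
proof -
  have "cinner u (ketbra v *v u) = cinner u v * cinner v u"
    by (simp add: cinner_def ketbra_def matrix_vector_mult_def sum_product sum_distrib_left
        mult_ac)
  then show ?thesis
    unfolding complex_norm_square cinner_commute[of u v] by (simp add: mult.commute)
qed

text \<open>Subtracting the normalised column i leaves the Schur complement. It is positive by
  completing the square: its form at \<open>u\<close> is the form of \<open>A\<close> at
  \<open>u + c *s axis i 1\<close> with the minimising value c = -(A u)_i / A_ii.\<close>

lemma psd_schur_step:
  fixes A :: "'n::finite operator"
  assumes A: "psd A" and i: "A $ i $ i \<noteq> 0"
  defines "v \<equiv> (\<chi> k. A $ k $ i / of_real (sqrt (Re (A $ i $ i))))"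
  shows "psd (A - ketbra v)" "(A - ketbra v) $ k $ l = A $ k $ l - A $ k $ i * A $ i $ l / A $ i $ i"
proof -
  define r where "r = Re (A $ i $ i)"
  have r: "A $ i $ i = of_real r" "r > 0"
    using psd_diag[OF A, of i] i by (auto simp: r_def complex_nonneg_Reals_iff complex_eq_iff)
  have sq: "complex_of_real (sqrt r) * of_real (sqrt r) = of_real r"
    using r by (simp flip: of_real_mult)
  have kb: "ketbra v $ k $ l = A $ k $ i * A $ i $ l / A $ i $ i" for k l
    using sq by (simp add: ketbra_def v_def r_def[symmetric] r(1) psd_hermitian[OF A, of i l])
  then show "(A - ketbra v) $ k $ l = A $ k $ l - A $ k $ i * A $ i $ l / A $ i $ i" by simp
  show "psd (A - ketbra v)"
    unfolding psd_def
  proof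
    fix u
    define b where "b = (A *v u) $ i"
    have "ketbra v *v u = (b / of_real r) *s (A *v axis i 1)"
      by (simp add: vec_eq_iff matrix_vector_mult_axis)
         (simp add: matrix_vector_mult_def kb b_def r(1) sum_distrib_left sum_divide_distrib mult_ac)
    then have e: "cinner u ((A - ketbra v) *v u) = cinner u (A *v u) - (b / of_real r) * cnj b"
      using cinner_add_right[of u "(A - ketbra v) *v u" "ketbra v *v u"]
      by (simp add: matrix_vector_mult_diff_rdistrib cinner_scale_right psd_cinner_axis[OF A] b_def)
    show "cinner u ((A - ketbra v) *v u) \<in> \<real>\<^sub>\<ge>\<^sub>0"
      using psd_form[OF A, of u "- (b / of_real r)" i] r(2)
      by (simp add: e psd_cinner_axis[OF A] b_def[symmetric] r(1) algebra_simps del: matrix_vector_mult_diff_rdistrib)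
  qed
qed

text \<open>Cholesky decomposition: each step clears one diagonal entry.\<close>

lemma psd_sum_ketbra:
  fixes A :: "'n::finite operator"
  assumes "psd A"
  obtains m v where "A = (\<Sum>k<m::nat. ketbra (v k))"
proof -
  have "\<exists>m v. A = (\<Sum>k<m::nat. ketbra (v k))" using assms
  proof (induction "card {i. A $ i $ i \<noteq> 0}" arbitrary: A rule: less_induct)
    case less
    show ?case
    proof (cases "\<exists>i. A $ i $ i \<noteq> 0")
      case False
      then have "A = 0" using psd_entry_0[OF less.prems] by (auto simp: vec_eq_iff)
      then show ?thesis by (intro exI[of _ 0]) simp
    next
      case True
      then obtain i where i: "A $ i $ i \<noteq> 0" by blast
      define v where "v = (\<chi> k. A $ k $ i / of_real (sqrt (Re (A $ i $ i))))"
      define A' where "A' = A - ketbra v"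
      have A': "psd A'" "\<And>k l. A' $ k $ l = A $ k $ l - A $ k $ i * A $ i $ l / A $ i $ i"
        using psd_schur_step[OF less.prems i] unfolding A'_def v_def by blast+
      \<comment> \<open>Entry i becomes zero, and a diagonal entry that is already zero stays so,
        because by \<open>psd_entry_0\<close> its whole column vanishes.\<close>
      have "{j. A' $ j $ j \<noteq> 0} \<subset> {j. A $ j $ j \<noteq> 0}"
      proof
        show "{j. A' $ j $ j \<noteq> 0} \<subseteq> {j. A $ j $ j \<noteq> 0}"
          using psd_entry_0[OF less.prems] by (auto simp: A')
        show "{j. A' $ j $ j \<noteq> 0} \<noteq> {j. A $ j $ j \<noteq> 0}"
          using i by (auto simp: A' set_eq_iff intro!: exI[of _ i])
      qed
      then have "card {j. A' $ j $ j \<noteq> 0} < card {j. A $ j $ j \<noteq> 0}"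
        by (intro psubset_card_mono) auto
      from less.hyps[OF this A'(1)] obtain m w where "A' = (\<Sum>k<m::nat. ketbra (w k))" by blast
      then have "A = (\<Sum>k<Suc m. ketbra ((w(m := v)) k))"
        by (simp add: A'_def algebra_simps)
      then show ?thesis by blast
    qed
  qed
  then show ?thesis using that by blast
qed

section \<open>Traces and norms of positive semidefinite operators\<close>

lemma matrix_add_rdistrib: "(A + B) ** C = A ** C + B ** (C :: 'n::finite operator)"
  by (simp add: vec_eq_iff matrix_matrix_mult_def algebra_simps sum.distrib)

lemma trace_zero: "trace (0 :: 'n::finite operator) = 0"
  by (simp add: trace_def)

lemma trace_sum:
  "trace (\<Sum>k\<in>K. A k) = (\<Sum>k\<in>K. trace (A k))" for A :: "'k \<Rightarrow> 'n::finite operator"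
  by (induction K rule: infinite_finite_induct) (auto simp: trace_add trace_zero)

lemma trace_ketbra: "trace (ketbra v) = of_real ((norm v)\<^sup>2)"
  unfolding cinner_self[symmetric] by (simp add: trace_def ketbra_def cinner_def mult.commute)

lemma trace_ketbra_mult: "trace (ketbra v ** B) = cinner v (B *v v)"
  by (simp add: trace_def ketbra_def cinner_def matrix_matrix_mult_def matrix_vector_mult_def
      sum_distrib_left mult.assoc mult.left_commute mult.commute)
     (subst sum.swap, simp add: mult_ac)

lemma trace_ketbra_ketbra: "trace (ketbra v ** ketbra w) = of_real ((cmod (cinner v w))\<^sup>2)"
  by (simp add: trace_ketbra_mult cinner_ketbra cmod_cinner_commute)

lemma trace_sum_ketbra_mult:
  "trace ((\<Sum>k<m. ketbra (v k)) ** ketbra w) = of_real (\<Sum>k<m. (cmod (cinner (v k) w))\<^sup>2)"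
  for m :: nat
proof (induction m)
  case 0
  then show ?case by (simp add: trace_zero)
next
  case (Suc m)
  then show ?case
    by (simp add: matrix_add_rdistrib trace_add trace_ketbra_ketbra)
qed

lemma trace_psd: "psd A \<Longrightarrow> trace A = of_real (Re (trace A)) \<and> Re (trace A) \<ge> 0"
  by (elim psd_sum_ketbra) (simp add: trace_sum trace_ketbra sum_nonneg flip: of_real_sum of_real_power)

lemma norm_ketbra: "norm (ketbra v) = (norm v)\<^sup>2"
proof -
  have 1: "(norm (ketbra v))\<^sup>2 = (\<Sum>i\<in>UNIV. (\<Sum>j\<in>UNIV. (cmod (v $ i))\<^sup>2 * (cmod (v $ j))\<^sup>2))"
    by (simp add: norm_vec_def L2_set_def sum_nonneg ketbra_def norm_mult power_mult_distrib)
  have 2: "(norm v)\<^sup>2 = (\<Sum>i\<in>UNIV. (cmod (v $ i))\<^sup>2)"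
    by (simp add: norm_vec_def L2_set_def sum_nonneg)
  have "(norm (ketbra v))\<^sup>2 = ((norm v)\<^sup>2)\<^sup>2"
    unfolding 1 2 power2_eq_square[of "sum _ _"] sum_product ..
  then show ?thesis by (simp only: power2_eq_iff_nonneg norm_ge_zero zero_le_power2)
qed

text \<open>An ensemble only provides integrability of the trace. This bound passes it on to the
  operator-valued function, so that the average state is a genuine integral.\<close>

lemma norm_psd_le: "psd A \<Longrightarrow> norm A \<le> Re (trace A)"
proof (elim psd_sum_ketbra)
  fix m v assume "A = (\<Sum>k<m::nat. ketbra (v k))"
  then show ?thesis
    by (simp add: trace_sum trace_ketbra) (rule sum_norm_le, simp add: norm_ketbra)
qed

text \<open>In rank-one decompositions of both operators the trace of the product becomes a sum of
  squared overlaps, and Cauchy-Schwarz bounds each of them. Applied to a state and an effect, this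
  is p \<le> a t.\<close>

lemma trace_mult_psd:
  assumes "psd A" "psd B"
  shows "Re (trace (A ** B)) \<ge> 0" "Re (trace (A ** B)) \<le> Re (trace A) * Re (trace B)"
proof -
  obtain m v where A: "A = (\<Sum>k<m::nat. ketbra (v k))" using psd_sum_ketbra[OF assms(1)] .
  obtain n w where B: "B = (\<Sum>k<n::nat. ketbra (w k))" using psd_sum_ketbra[OF assms(2)] .
  have "trace (A ** (\<Sum>k<j. ketbra (w k))) = of_real (\<Sum>l<j. \<Sum>k<m. (cmod (cinner (v k) (w l)))\<^sup>2)" for j :: nat
    by (induction j) (simp_all add: trace_zero matrix_add_ldistrib trace_add A trace_sum_ketbra_mult)
  then have e: "Re (trace (A ** B)) = (\<Sum>l<n. \<Sum>k<m. (cmod (cinner (v k) (w l)))\<^sup>2)"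
    by (simp add: B)
  show "Re (trace (A ** B)) \<ge> 0" unfolding e by (intro sum_nonneg) simp
  have "(\<Sum>l<n. \<Sum>k<m. (cmod (cinner (v k) (w l)))\<^sup>2) \<le> (\<Sum>l<n. \<Sum>k<m. (norm (v k))\<^sup>2 * (norm (w l))\<^sup>2)"
    by (intro sum_mono) (metis cmod_cinner_le norm_ge_zero power_mono power_mult_distrib)
  also have "\<dots> = Re (trace A) * Re (trace B)"
    by (simp add: A B trace_sum trace_ketbra sum_product) (rule sum.swap)
  finally show "Re (trace (A ** B)) \<le> Re (trace A) * Re (trace B)" unfolding e .
qed

text \<open>All rows are multiples of one vector, so a single Schur step already leaves
  zero.\<close>

lemma psd_rank_one_ketbra:
  fixes A :: "'n::finite operator"
  assumes "psd A" "rank A = 1"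
  obtains w where "A = ketbra w"
proof -
  have "vec.dim (rows A) = 1" using assms(2) by (simp add: row_rank_def_gen)
  then obtain B where B: "vec.independent B" "B \<subseteq> rows A" "rows A \<subseteq> vec.span B" "card B = 1"
    by (metis vec.basis_exists)
  then obtain u where u: "B = {u}" by (auto simp: card_1_singleton_iff)
  have "\<exists>c. row i A = c *s u" for i
    using B(3) unfolding u vec.span_singleton by (auto simp: rows_def)
  then obtain c where c: "\<And>i. row i A = c i *s u" by metis
  have e: "A $ i $ j = c i * u $ j" for i j
    using c[of i] by (simp add: row_def vec_eq_iff)
  have "A \<noteq> 0"
  proof
    assume "A = 0"
    then have "rows A \<subseteq> {0}" by (auto simp: rows_def row_def vec_eq_iff)
    then show False using B(1,2) u vec.dependent_zero by auto
  qed
  then obtain i where i: "A $ i $ i \<noteq> 0"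
    using psd_entry_0[OF assms(1)] by (auto simp: vec_eq_iff)
  have "A - ketbra (\<chi> k. A $ k $ i / of_real (sqrt (Re (A $ i $ i)))) = 0"
    using i unfolding vec_eq_iff psd_schur_step(2)[OF assms(1) i] by (simp add: e)
  then show ?thesis using that by simp
qed

section \<open>The Gaussian measure\<close>

lemma nn_integral_lborel_shift:
  fixes f :: "'a::euclidean_space \<Rightarrow> ennreal"
  assumes [measurable]: "f \<in> borel_measurable borel"
  shows "(\<integral>\<^sup>+x. f (x + a) \<partial>lborel) = (\<integral>\<^sup>+x. f x \<partial>lborel)"
    and "(\<integral>\<^sup>+x. f (a - x) \<partial>lborel) = (\<integral>\<^sup>+x. f x \<partial>lborel)"
proof -
  have 1: "lborel = distr (lborel::'a measure) borel (\<lambda>x. x + a)"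
    using lborel_affine[of 1 a] by (simp add: density_1 add.commute)
  show "(\<integral>\<^sup>+x. f (x + a) \<partial>lborel) = (\<integral>\<^sup>+x. f x \<partial>lborel)"
    by (subst (2) 1) (simp add: nn_integral_distr)
  have 2: "lborel = distr (lborel::'a measure) borel (\<lambda>x. a - x)"
    using lborel_affine[of "-1" a] by (simp add: density_1)
  show "(\<integral>\<^sup>+x. f (a - x) \<partial>lborel) = (\<integral>\<^sup>+x. f x \<partial>lborel)"
    by (subst (2) 2) (simp add: nn_integral_distr)
qed

text \<open>
  Uniqueness of translation invariant measures: the image under \<open>T\<close> of the measure with density
  \<open>g\<close> is invariant under translations, hence proportional to Lebesgue measure.
\<close>

lemma nn_integral_lborel_fibre:
  fixes T :: "'a::euclidean_space \<Rightarrow> 'b::euclidean_space" and F B :: "'b \<Rightarrow> ennreal"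
  assumes [measurable]: "T \<in> borel_measurable borel" "g \<in> borel_measurable borel"
      "F \<in> borel_measurable borel" "B \<in> borel_measurable borel"
    and T: "\<And>z w. T (z + S w) = T z + w" and g: "\<And>z w. g (z + S w) = g z"
  shows "(\<integral>\<^sup>+z. F (T z) * g z \<partial>lborel) * (\<integral>\<^sup>+w. B w \<partial>lborel) =
         (\<integral>\<^sup>+z. B (T z) * g z \<partial>lborel) * (\<integral>\<^sup>+w. F w \<partial>lborel)"
proof -
  have "(\<integral>\<^sup>+z. F (T z) * g z \<partial>lborel) * (\<integral>\<^sup>+w. B w \<partial>lborel) =
      (\<integral>\<^sup>+z. (\<integral>\<^sup>+w. F (T z) * g z * B w \<partial>lborel) \<partial>lborel)"
    by (simp add: nn_integral_cmult nn_integral_multc)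
  also have "\<dots> = (\<integral>\<^sup>+z. (\<integral>\<^sup>+w. F (T z) * g z * B (w + T z) \<partial>lborel) \<partial>lborel)"
    by (simp add: nn_integral_cmult nn_integral_lborel_shift)
  also have "\<dots> = (\<integral>\<^sup>+w. (\<integral>\<^sup>+z. F (T z) * g z * B (w + T z) \<partial>lborel) \<partial>lborel)"
    by (rule lborel_pair.Fubini') measurable
  also have "\<dots> = (\<integral>\<^sup>+w. (\<integral>\<^sup>+z. F (T z - w) * g z * B (T z) \<partial>lborel) \<partial>lborel)"
  proof (rule nn_integral_cong)
    \<comment> \<open>Translating z by \<open>S (- w)\<close> replaces \<open>T z\<close> by
      \<open>T z - w\<close> and leaves \<open>g\<close> unchanged.\<close>
    fix w
    show "(\<integral>\<^sup>+z. F (T z) * g z * B (w + T z) \<partial>lborel) = (\<integral>\<^sup>+z. F (T z - w) * g z * B (T z) \<partial>lborel)"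
      by (subst nn_integral_lborel_shift(1)[symmetric, of _ "S (- w)"]) (simp_all add: T g)
  qed
  also have "\<dots> = (\<integral>\<^sup>+z. (\<integral>\<^sup>+w. F (T z - w) * g z * B (T z) \<partial>lborel) \<partial>lborel)"
    by (rule lborel_pair.Fubini') measurable
  also have "\<dots> = (\<integral>\<^sup>+z. B (T z) * g z \<partial>lborel) * (\<integral>\<^sup>+w. F w \<partial>lborel)"
  proof -
    have "(\<integral>\<^sup>+w. F (T z - w) * g z * B (T z) \<partial>lborel) = B (T z) * g z * (\<integral>\<^sup>+w. F w \<partial>lborel)" for z
      by (simp add: nn_integral_multc nn_integral_lborel_shift) (simp add: mult_ac)
    then show ?thesis by (simp add: nn_integral_multc)
  qed
  finally show ?thesis .
qed

text \<open>A replacement for polar coordinates: the ball of squared radius a has volume V a^(k+1),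
  and the density is the derivative of this volume in a. Even dimension turns the Gamma function
  into a factorial.\<close>

lemma distr_norm_sq_lborel:
  assumes D: "DIM('a::euclidean_space) = 2 * Suc k"
  shows "distr lborel borel (\<lambda>z::'a. (norm z)\<^sup>2) =
    density lborel (\<lambda>t. ennreal (pi powr Suc k / fact k * t ^ k) * indicator {0..} t)"
    (is "?L = ?R")
proof (rule measure_eqI_generator_eq[where E = "range atMost" and \<Omega> = UNIV and A = "\<lambda>i. {..real i}"])
  define V where "V = pi powr Suc k / fact (Suc k)"
  have V: "unit_ball_vol (real (2 * Suc k)) = V" "pi powr Suc k / fact k = V * Suc k" "V \<ge> 0"
  proof -
    have "real (2 * Suc k) / 2 = real (Suc k)" by simp
    moreover have "Gamma (real (Suc k) + 1) = fact (Suc k)"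
      by (metis Gamma_fact add.commute of_nat_Suc)
    ultimately show "unit_ball_vol (real (2 * Suc k)) = V"
      unfolding unit_ball_vol_def V_def by (metis of_nat_Suc)
  qed (simp_all add: V_def divide_simps fact_Suc del: of_nat_Suc)
  have L: "emeasure ?L {..a} = (if a < 0 then 0 else ennreal (V * a ^ Suc k))" for a
  proof (cases "a < 0")
    case True
    then have "{z::'a. (norm z)\<^sup>2 \<le> a} = {}" by (auto simp: not_le intro: less_le_trans[OF _ zero_le_power2])
    then show ?thesis using True by (simp add: emeasure_distr vimage_def)
  next
    case False
    then have "{z::'a. (norm z)\<^sup>2 \<le> a} = cball 0 (sqrt a)" by (auto simp: real_le_rsqrt sqrt_ge_absD)
    moreover have "sqrt a ^ (2 * Suc k) = a ^ Suc k"
      using False by (subst power_mult) simp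
    ultimately show ?thesis using False
      by (simp add: emeasure_distr vimage_def emeasure_cball D V del: mult_Suc_right power_Suc of_nat_mult)
  qed
  have R: "emeasure ?R {..a} = (if a < 0 then 0 else ennreal (V * a ^ Suc k))" for a
  proof (cases "a < 0")
    case True
    then have "(\<lambda>t. ennreal (pi powr Suc k / fact k * t ^ k) * indicator {0..} t * indicator {..a} t) = (\<lambda>t. 0)"
      by (auto simp: fun_eq_iff split: split_indicator)
    with True show ?thesis by (simp add: emeasure_density)
  next
    case False
    have "emeasure ?R {..a} = (\<integral>\<^sup>+t. ennreal (V * Suc k * t ^ k) * indicator {0..a} t \<partial>lborel)"
      unfolding V(2) by (auto simp: emeasure_density intro!: nn_integral_cong split: split_indicator)
    also have "\<dots> = ennreal (V * a ^ Suc k - V * 0 ^ Suc k)"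
    proof (rule nn_integral_FTC_Icc[where F = "\<lambda>t. V * t ^ Suc k"])
      show "((\<lambda>t. V * t ^ Suc k) has_real_derivative V * Suc k * x ^ k) (at x)" for x
        using DERIV_cmult[OF DERIV_pow[of "Suc k" x UNIV], of V] by (simp add: mult.assoc)
    qed (use False V(3) in auto)
    finally show ?thesis using False by simp
  qed
  show "emeasure ?L X = emeasure ?R X" if "X \<in> range atMost" for X
    using that L R by auto
  show "emeasure ?L {..real i} \<noteq> \<infinity>" for i by (simp only: L) simp
  show "Int_stable (range (atMost :: real \<Rightarrow> _))" by (auto simp: Int_stable_def)
  show "sets ?L = sigma_sets UNIV (range atMost)" "sets ?R = sigma_sets UNIV (range atMost)"
    by (simp_all add: borel_eq_atMost)
  show "(\<Union>i. {..real i}) = UNIV" by (auto intro: real_arch_simple)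
qed auto

text \<open>The variance is 1/2 in every real direction, so that the squared modulus of a complex
  coordinate is exponential with mean 1.\<close>

definition gauss :: "'a::euclidean_space measure" where
  "gauss = density lborel (\<lambda>z. ennreal (exp (- (norm z)\<^sup>2) / pi powr (DIM('a) / 2)))"

lemma sets_gauss [measurable_cong, simp]: "sets gauss = sets borel"
  by (simp add: gauss_def)

lemma space_gauss [simp]: "space gauss = UNIV"
  by (simp add: gauss_def)

lemma distr_norm_sq_gauss:
  assumes D: "DIM('a::euclidean_space) = 2 * Suc k"
  shows "distr gauss borel (\<lambda>z::'a. (norm z)\<^sup>2) = density lborel (erlang_density k 1)"
proof -
  have "distr gauss borel (\<lambda>z::'a. (norm z)\<^sup>2) =
      density (distr lborel borel (\<lambda>z::'a. (norm z)\<^sup>2)) (\<lambda>t. ennreal (exp (- t) / pi powr Suc k))"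
  proof -
    have e: "real DIM('a) / 2 = real (Suc k)" by (simp add: D)
    show ?thesis unfolding gauss_def e by (subst density_distr) (simp_all add: comp_def)
  qed
  also have "\<dots> = density lborel (erlang_density k 1)"
    unfolding distr_norm_sq_lborel[OF D]
    by (subst density_density_eq)
       (auto intro!: density_cong AE_I2 split: split_indicator
         simp: erlang_density_def ennreal_mult'[symmetric] exp_minus field_simps)
  finally show ?thesis .
qed

text \<open>The normalisation is read off from the law of the squared norm, which is an Erlang
  distribution and hence has mass 1.\<close>

lemma prob_space_gauss:
  assumes "even DIM('a::euclidean_space)"
  shows "prob_space (gauss :: 'a measure)"
proof -
  obtain k where k: "DIM('a) = 2 * Suc k"
    using assms DIM_positive[where 'a = 'a] by (metis dvd_def mult_0_right neq0_conv not0_implies_Suc)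
  have "prob_space (distr gauss borel (\<lambda>z::'a. (norm z)\<^sup>2))"
    unfolding distr_norm_sq_gauss[OF k] by (rule prob_space_erlang_density) simp
  then show ?thesis by (rule prob_space_distrD[rotated]) simp
qed

lemma nn_integral_exp_norm_sq:
  assumes "even DIM('a::euclidean_space)"
  shows "(\<integral>\<^sup>+(z::'a). ennreal (exp (- (norm z)\<^sup>2)) \<partial>lborel) = ennreal (pi powr (DIM('a) / 2))"
proof -
  let ?c = "pi powr (DIM('a) / 2)"
  have "1 = (\<integral>\<^sup>+(z::'a). 1 \<partial>gauss)"
    using prob_space.emeasure_space_1[OF prob_space_gauss[OF assms]] by simp
  also have "\<dots> = (\<integral>\<^sup>+(z::'a). ennreal (1 / ?c) * ennreal (exp (- (norm z)\<^sup>2)) \<partial>lborel)"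
    unfolding gauss_def by (subst nn_integral_density) (simp_all add: ennreal_mult'[symmetric])
  also have "\<dots> = ennreal (1 / ?c) * (\<integral>\<^sup>+(z::'a). ennreal (exp (- (norm z)\<^sup>2)) \<partial>lborel)"
    by (rule nn_integral_cmult) simp
  finally have "ennreal ?c * 1 = (ennreal ?c * ennreal (1 / ?c)) * (\<integral>\<^sup>+(z::'a). ennreal (exp (- (norm z)\<^sup>2)) \<partial>lborel)"
    by (simp add: mult.assoc)
  then show ?thesis by (simp add: ennreal_mult'[symmetric])
qed

text \<open>Translating z by \<open>S w\<close> moves \<open>T z\<close> by w, and by assumption the
  squared norm of z exceeds that of \<open>T z\<close> by an amount constant along these
  translations. This covers both isometries and the overlap with a unit vector.\<close>

lemma distr_gauss:
  fixes T :: "'a::euclidean_space \<Rightarrow> 'b::euclidean_space"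
  assumes "even DIM('a)" "even DIM('b)" and [measurable]: "T \<in> borel_measurable borel"
    and T: "\<And>z w. T (z + S w) = T z + w"
    and g: "\<And>z w. (norm (z + S w))\<^sup>2 - (norm (T z + w))\<^sup>2 = (norm z)\<^sup>2 - (norm (T z))\<^sup>2"
  shows "distr gauss borel T = gauss"
proof (rule measure_eqI)
  fix A assume "A \<in> sets (distr gauss borel T)"
  then have [measurable]: "A \<in> sets borel" by simp
  have [measurable]: "T -` A \<in> sets borel"
    using measurable_sets[OF assms(3), of A] by simp
  define a b where "a = pi powr (DIM('a) / 2)" and "b = pi powr (DIM('b) / 2)"
  have pos: "a > 0" "b > 0" by (simp_all add: a_def b_def)
  define F where "F w = indicator A w * ennreal (exp (- (norm w)\<^sup>2))" for w :: 'b
  have [measurable]: "F \<in> borel_measurable borel" unfolding F_def[abs_def] by measurable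
  \<comment> \<open>The Gaussian density of the source is that of the target, pulled back along
    \<open>T\<close>, times the translation invariant factor \<open>h\<close>. The unnormalised
    Gaussian serves as the reference function \<open>B\<close> of
    \<open>nn_integral_lborel_fibre\<close>, so that its integrals are the known constants a and
    b.\<close>
  define h where "h z = ennreal (exp ((norm (T z))\<^sup>2 - (norm z)\<^sup>2))" for z
  have [measurable]: "h \<in> borel_measurable borel" unfolding h_def[abs_def] by measurable
  have h: "h (z + S w) = h z" for z w
    using g[of z w] by (simp add: h_def T)
  have eh: "ennreal (exp (- (norm (T z))\<^sup>2)) * h z = ennreal (exp (- (norm z)\<^sup>2))" for z
    by (simp add: h_def ennreal_mult'[symmetric] exp_add[symmetric])
  have "(\<integral>\<^sup>+z. F (T z) * h z \<partial>lborel) * (\<integral>\<^sup>+(w::'b). ennreal (exp (- (norm w)\<^sup>2)) \<partial>lborel) =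
      (\<integral>\<^sup>+z. ennreal (exp (- (norm (T z))\<^sup>2)) * h z \<partial>lborel) * (\<integral>\<^sup>+w. F w \<partial>lborel)"
    by (rule nn_integral_lborel_fibre[OF _ _ _ _ T h]) simp_all
  then have "(\<integral>\<^sup>+z. F (T z) * h z \<partial>lborel) * ennreal b = ennreal a * (\<integral>\<^sup>+w. F w \<partial>lborel)"
    by (simp add: eh nn_integral_exp_norm_sq assms a_def b_def)
  then have "ennreal (1/a) * ennreal (1/b) * ((\<integral>\<^sup>+z. F (T z) * h z \<partial>lborel) * ennreal b)
      = ennreal (1/a) * ennreal (1/b) * (ennreal a * (\<integral>\<^sup>+w. F w \<partial>lborel))" by simp
  moreover have "ennreal (1/a) * ennreal a = 1" "ennreal (1/b) * ennreal b = 1"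
    using pos by (simp_all add: ennreal_mult'[symmetric])
  ultimately have eq: "ennreal (1/a) * (\<integral>\<^sup>+z. F (T z) * h z \<partial>lborel) = ennreal (1/b) * (\<integral>\<^sup>+w. F w \<partial>lborel)"
    by (metis (no_types, lifting) mult.assoc mult.commute mult.right_neutral)
  have "emeasure (distr gauss borel T) A = (\<integral>\<^sup>+z. ennreal (1/a) * (F (T z) * h z) \<partial>lborel)"
    using pos by (auto simp: emeasure_distr gauss_def emeasure_density F_def mult.assoc eh a_def[symmetric]
        ennreal_mult'[symmetric] intro!: nn_integral_cong split: split_indicator)
  also have "\<dots> = ennreal (1/a) * (\<integral>\<^sup>+z. F (T z) * h z \<partial>lborel)"
    by (rule nn_integral_cmult) simp
  also note eq
  also have "ennreal (1/b) * (\<integral>\<^sup>+w. F w \<partial>lborel) = (\<integral>\<^sup>+w. ennreal (1/b) * F w \<partial>lborel)"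
    by (rule nn_integral_cmult[symmetric]) simp
  also have "\<dots> = emeasure gauss A"
    using pos by (auto simp: gauss_def emeasure_density F_def b_def[symmetric]
        ennreal_mult'[symmetric] intro!: nn_integral_cong split: split_indicator)
  finally show "emeasure (distr gauss borel T) A = emeasure gauss A" .
qed simp

section \<open>Entropy integrals of the Erlang distributions\<close>

text \<open>In closed form this is (k+1) digamma(k+2).\<close>

definition erlang_ent :: "nat \<Rightarrow> real" where
  "erlang_ent k = (\<integral>t. erlang_density k 1 t * (t * ln t) \<partial>lborel)"

lemma integrable_erlang_power: "integrable lborel (\<lambda>t. erlang_density k 1 t * t ^ i)"
proof (rule integrableI_nonneg)
  show "(\<integral>\<^sup>+t. ennreal (erlang_density k 1 t * t ^ i) \<partial>lborel) < \<infinity>"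
    by (subst nn_integral_erlang_ith_moment) simp_all
qed (auto simp: erlang_density_def)

lemma integral_erlang_power: "(\<integral>t. erlang_density k 1 t * t ^ i \<partial>lborel) = fact (k + i) / fact k"
  using nn_integral_erlang_ith_moment[of 1 k i]
  by (intro integral_eq_nn_integral[THEN trans]) (auto simp: erlang_density_def)

text \<open>Reduces integrability of t ln t to that of the moments of order 0 and 2.\<close>

lemma abs_mult_ln_le: "0 \<le> t \<Longrightarrow> \<bar>t * ln t\<bar> \<le> 1 + t ^ 2" for t :: real
proof (cases "t = 0")
  case False
  assume "0 \<le> t"
  with False have t: "t > 0" by simp
  have "t * ln t \<le> t * t"
    using t ln_bound[of t] by (intro mult_left_mono) auto
  moreover have "- ln t \<le> 1 / t"
    using t ln_bound[of "1 / t"] by (simp add: ln_div)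
  then have "t * (- ln t) \<le> t * (1 / t)"
    using t by (intro mult_left_mono) auto
  ultimately show ?thesis
    using t by (simp add: abs_le_iff power2_eq_square add_increasing add_increasing2 del: mult_le_cancel_left_pos)
qed simp

lemma integrable_erlang_ent: "integrable lborel (\<lambda>t. erlang_density k 1 t * (t * ln t))"
proof (rule Bochner_Integration.integrable_bound)
  show "integrable lborel (\<lambda>t. erlang_density k 1 t * t ^ 0 + erlang_density k 1 t * t ^ 2)"
    by (intro Bochner_Integration.integrable_add integrable_erlang_power)
  show "AE t in lborel. norm (erlang_density k 1 t * (t * ln t)) \<le>
      norm (erlang_density k 1 t * t ^ 0 + erlang_density k 1 t * t ^ 2)"
  proof (rule AE_I2)
    fix t :: real
    show "norm (erlang_density k 1 t * (t * ln t)) \<le>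
        norm (erlang_density k 1 t * t ^ 0 + erlang_density k 1 t * t ^ 2)"
    proof (cases "t \<ge> 0")
      case True
      then have "erlang_density k 1 t * \<bar>t * ln t\<bar> \<le> erlang_density k 1 t * (1 + t ^ 2)"
        by (intro mult_left_mono abs_mult_ln_le) auto
      then show ?thesis
        by (simp add: abs_mult[of "erlang_density k 1 t"] distrib_left)
    qed (simp add: erlang_density_def)
  qed
qed measurable

text \<open>The recurrence of the digamma function, obtained by integrating a derivative whose
  primitive vanishes at both ends of the half-line.\<close>

lemma erlang_ent_Suc: "erlang_ent (Suc k) / (real k + 2) = erlang_ent k / (real k + 1) + 1 / (real k + 2)"
proof -
  define F :: "real \<Rightarrow> real" where "F t = t ^ (k + 2) * ln t * exp (- t) / fact (k + 1)" for t
  \<comment> \<open>\<open>f\<close> is the derivative of \<open>F\<close> on the positive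
    half-line, written with Erlang densities so that its integral is linear in the two
    entropies.\<close>
  define f where "f t = (real k + 2) / (real k + 1) * (erlang_density k 1 t * (t * ln t))
      + erlang_density k 1 t * t / (real k + 1) - erlang_density (Suc k) 1 t * (t * ln t)" for t :: real
  have f: "f t = ((real k + 2) * t ^ (k + 1) * ln t + t ^ (k + 1) - t ^ (k + 2) * ln t) * exp (- t) / fact (k + 1)"
    if "t > 0" for t :: real
    using that by (simp add: f_def erlang_density_def divide_simps del: of_nat_Suc) (simp add: algebra_simps)
  have int: "integrable lborel f"
    using integrable_erlang_power[of k 1]
    unfolding f_def by (intro Bochner_Integration.integrable_diff Bochner_Integration.integrable_add
        integrable_mult_right integrable_erlang_ent) simp
  have "(LBINT t=ereal 0..\<infinity>. f t) = 0 - 0"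
  proof (rule interval_integral_FTC_integrable)
    fix t :: real assume "ereal 0 < ereal t"
    then have t: "t > 0" by simp
    have "(F has_real_derivative f t) (at t)"
      unfolding F_def f[OF t] using t
      by (auto intro!: derivative_eq_intros simp: divide_simps simp del: fact_Suc)
         (simp add: algebra_simps; cases k; simp)
    then show "(F has_vector_derivative f t) (at t)"
      by (simp add: has_real_derivative_iff_has_vector_derivative)
    have "isCont (\<lambda>t. ((real k + 2) * t ^ (k + 1) * ln t + t ^ (k + 1) - t ^ (k + 2) * ln t) * exp (- t) / fact (k + 1)) t"
      using t by (intro continuous_intros) auto
    moreover have "\<forall>\<^sub>F s in nhds t. f s =
        ((real k + 2) * s ^ (k + 1) * ln s + s ^ (k + 1) - s ^ (k + 2) * ln s) * exp (- s) / fact (k + 1)"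
      using t by (intro eventually_mono[OF eventually_nhds_in_open[of "{0<..}" t]]) (auto simp: f)
    ultimately show "isCont f t"
      by (subst isCont_cong)
  next
    show "set_integrable lborel (einterval (ereal 0) \<infinity>) f"
      using int unfolding set_integrable_def by (intro integrable_mult_indicator) auto
    \<comment> \<open>\<open>F\<close> contains the power t^(k+2); one factor t absorbs the
      logarithm at 0 and the rest still tends to 0.\<close>
    have lim0: "((\<lambda>t::real. t * ln t) \<longlongrightarrow> 0) (at_right 0)"
    proof -
      have "((\<lambda>t::real. - (ln (inverse t) / inverse t)) \<longlongrightarrow> - 0) (at_right 0)"
        by (intro tendsto_minus filterlim_compose[OF ln_x_over_x_tendsto_0 filterlim_inverse_at_top_right])
      then have "((\<lambda>t::real. - (ln (inverse t) / inverse t)) \<longlongrightarrow> 0) (at_right 0)"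
        by simp
      moreover have "\<forall>\<^sub>F t::real in at_right 0. - (ln (inverse t) / inverse t) = t * ln t"
        by (rule eventually_mono[OF eventually_at_right_less[of 0]]) (simp add: ln_div field_simps)
      ultimately show ?thesis by (rule Lim_transform_eventually)
    qed
    have "isCont (\<lambda>t::real. t ^ (k + 1) * exp (- t) / fact (k + 1)) 0"
      by (intro continuous_intros) auto
    then have "((\<lambda>t::real. t ^ (k + 1) * exp (- t) / fact (k + 1)) \<longlongrightarrow> 0) (at_right 0)"
      unfolding isCont_def by (auto intro: tendsto_within_subset)
    from tendsto_mult[OF this lim0]
    have "((\<lambda>t::real. t ^ (k + 1) * exp (- t) / fact (k + 1) * (t * ln t)) \<longlongrightarrow> 0) (at_right 0)"
      by simp
    then have "(F \<longlongrightarrow> 0) (at_right 0)"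
      by (simp add: F_def[abs_def] mult_ac)
    then show "((F \<circ> real_of_ereal) \<longlongrightarrow> 0) (at_right (ereal 0))"
      by (simp only: ereal_tendsto_simps)
    have "((\<lambda>t::real. (t ^ (k + 3) / exp t) * (ln t / t) / fact (k + 1)) \<longlongrightarrow> 0 * 0 / fact (k + 1)) at_top"
      by (intro tendsto_intros tendsto_power_div_exp_0 ln_x_over_x_tendsto_0) auto
    then have "((\<lambda>t::real. (t ^ (k + 3) / exp t) * (ln t / t) / fact (k + 1)) \<longlongrightarrow> 0) at_top"
      by simp
    moreover have "\<forall>\<^sub>F t in at_top. (t ^ (k + 3) / exp t) * (ln t / t) / fact (k + 1) = F t"
      by (rule eventually_mono[OF eventually_gt_at_top[of 0]])
         (simp add: F_def exp_minus field_simps power_add eval_nat_numeral)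
    ultimately have "(F \<longlongrightarrow> 0) at_top" by (rule Lim_transform_eventually)
    then show "((F \<circ> real_of_ereal) \<longlongrightarrow> 0) (at_left \<infinity>)"
      by (simp only: ereal_tendsto_simps)
  qed simp
  then have "(\<integral>t. indicator {0<..} t *\<^sub>R f t \<partial>lborel) = 0"
    unfolding interval_integral_to_infinity_eq set_lebesgue_integral_def by simp
  moreover have "(\<integral>t. indicator {0<..} t *\<^sub>R f t \<partial>lborel) = (\<integral>t. f t \<partial>lborel)"
    by (rule Bochner_Integration.integral_cong)
       (auto simp: f_def erlang_density_def split: split_indicator)
  moreover have "(\<integral>t. f t \<partial>lborel) = (real k + 2) / (real k + 1) * erlang_ent k + 1 - erlang_ent (Suc k)"
    using integrable_erlang_power[of k 1] integral_erlang_power[of k 1]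
    unfolding f_def erlang_ent_def by (simp add: integrable_erlang_ent)
  ultimately have "erlang_ent (Suc k) = (real k + 2) / (real k + 1) * erlang_ent k + 1" by simp
  moreover have "(b / a * c + 1) / b = c / a + 1 / b" if "a \<noteq> 0" "b \<noteq> 0" for a b c :: real
    using that by (simp add: field_simps)
  ultimately show ?thesis by simp
qed

text \<open>The constant \<open>erlang_ent 0\<close> stays symbolic: the overlap contributes the
  same constant in \<open>nn_integral_gauss_ent\<close>, and the two cancel.\<close>

lemma erlang_ent_eq: "erlang_ent k / (real k + 1) = erlang_ent 0 + (\<Sum>n=2..Suc k. 1 / real n)"
proof (induction k)
  case (Suc k)
  then show ?case
    using erlang_ent_Suc[of k] by (simp add: add_ac)
qed simp

section \<open>Gaussian average of the entropy of an overlap\<close>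

lemma
  assumes D: "DIM('a::euclidean_space) = 2 * Suc k"
  shows integrable_gauss_norm_sq_ln: "integrable gauss (\<lambda>z::'a. (norm z)\<^sup>2 * ln ((norm z)\<^sup>2))"
    and integral_gauss_norm_sq_ln: "(\<integral>z. (norm z)\<^sup>2 * ln ((norm z)\<^sup>2) \<partial>(gauss::'a measure)) = erlang_ent k"
    and integrable_gauss_norm_sq: "integrable gauss (\<lambda>z::'a. (norm z)\<^sup>2)"
    and integral_gauss_norm_sq: "(\<integral>z. (norm z)\<^sup>2 \<partial>(gauss::'a measure)) = real (Suc k)"
proof -
  have i: "integrable gauss (\<lambda>z::'a. f ((norm z)\<^sup>2)) \<longleftrightarrow> integrable lborel (\<lambda>t. erlang_density k 1 t * f t)"
    and e: "(\<integral>z. f ((norm z)\<^sup>2) \<partial>(gauss::'a measure)) = (\<integral>t. erlang_density k 1 t * f t \<partial>lborel)"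
    if [measurable]: "f \<in> borel_measurable borel" for f :: "real \<Rightarrow> real"
  proof -
    have "integrable gauss (\<lambda>z::'a. f ((norm z)\<^sup>2)) \<longleftrightarrow> integrable (distr gauss borel (\<lambda>z::'a. (norm z)\<^sup>2)) f"
      by (rule integrable_distr_eq[symmetric]) measurable
    then show "integrable gauss (\<lambda>z::'a. f ((norm z)\<^sup>2)) \<longleftrightarrow> integrable lborel (\<lambda>t. erlang_density k 1 t * f t)"
      unfolding distr_norm_sq_gauss[OF D] by (subst (asm) integrable_density) auto
    have "(\<integral>z. f ((norm z)\<^sup>2) \<partial>(gauss::'a measure)) = integral\<^sup>L (distr gauss borel (\<lambda>z::'a. (norm z)\<^sup>2)) f"
      by (rule integral_distr[symmetric]) measurable
    then show "(\<integral>z. f ((norm z)\<^sup>2) \<partial>(gauss::'a measure)) = (\<integral>t. erlang_density k 1 t * f t \<partial>lborel)"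
      unfolding distr_norm_sq_gauss[OF D] by (subst (asm) integral_density) auto
  qed
  show "integrable gauss (\<lambda>z::'a. (norm z)\<^sup>2 * ln ((norm z)\<^sup>2))"
    using i[of "\<lambda>t. t * ln t"] integrable_erlang_ent by simp
  show "(\<integral>z. (norm z)\<^sup>2 * ln ((norm z)\<^sup>2) \<partial>(gauss::'a measure)) = erlang_ent k"
    using e[of "\<lambda>t. t * ln t"] by (simp add: erlang_ent_def)
  show "integrable gauss (\<lambda>z::'a. (norm z)\<^sup>2)"
    using i[of "\<lambda>t. t"] integrable_erlang_power[of k 1] by simp
  show "(\<integral>z. (norm z)\<^sup>2 \<partial>(gauss::'a measure)) = real (Suc k)"
    using e[of "\<lambda>t. t"] integral_erlang_power[of k 1] by simp
qed

section \<open>Hyperplane reflections and the average over directions\<close>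

definition reflection :: "'a::real_inner \<Rightarrow> 'a \<Rightarrow> 'a" where
  "reflection v z = z - (2 * (z \<bullet> v) / (v \<bullet> v)) *\<^sub>R v"

lemma reflection_add: "reflection v (z + w) = reflection v z + reflection v w"
  by (simp add: reflection_def inner_add_left algebra_simps add_divide_distrib)

lemma reflection_involution: "reflection v (reflection v z) = z"
  by (cases "v = 0") (simp_all add: reflection_def inner_diff_left)

lemma norm_reflection: "norm (reflection v z) = norm z"
  by (cases "v = 0")
    (simp_all add: reflection_def norm_eq_sqrt_inner inner_diff_left inner_diff_right inner_commute[of v z])

text \<open>The reflection along a - b is self-adjoint and swaps two vectors of equal norm. Equality
  of the norms is what gives the relation between \<open>v \<bullet> v\<close> and
  \<open>v \<bullet> a\<close> below.\<close>

lemma inner_reflection: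
  assumes "norm a = norm b"
  shows "reflection (a - b) z \<bullet> a = z \<bullet> b"
proof (cases "a = b")
  case False
  define v where "v = a - b"
  have "a \<bullet> a = b \<bullet> b" using assms by (simp add: dot_square_norm)
  then have v: "v \<bullet> v = 2 * (v \<bullet> a)"
    by (simp add: v_def algebra_simps inner_commute)
  have "v \<bullet> v \<noteq> 0" using False by (simp add: v_def)
  then have "v \<bullet> a \<noteq> 0" unfolding v by simp
  then have "reflection v z \<bullet> a = z \<bullet> a - z \<bullet> v"
    by (simp add: reflection_def inner_diff_left v)
  then show ?thesis by (simp add: v_def inner_diff_right)
qed (simp add: reflection_def)

lemma distr_gauss_reflection:
  assumes "even DIM('a::euclidean_space)"
  shows "distr gauss borel (reflection (v::'a)) = gauss"
proof (rule distr_gauss[where S = "reflection v"])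
  show "reflection v \<in> borel_measurable borel" unfolding reflection_def[abs_def] by measurable
  fix z w
  show *: "reflection v (z + reflection v w) = reflection v z + w"
    by (simp add: reflection_add reflection_involution)
  have "norm (reflection v z + w) = norm (z + reflection v w)"
    by (metis * norm_reflection)
  then show "(norm (z + reflection v w))\<^sup>2 - (norm (reflection v z + w))\<^sup>2 =
      (norm z)\<^sup>2 - (norm (reflection v z))\<^sup>2"
    by (simp add: norm_reflection)
qed (use assms in auto)

text \<open>All directions contribute equally, and over a basis the contributions sum to the radial integral.\<close>

lemma
  fixes a :: "'a::euclidean_space"
  assumes D: "DIM('a) = 2 * Suc k" and a: "norm a = 1"
  shows integrable_gauss_inner_ln: "integrable gauss (\<lambda>z::'a. (z \<bullet> a)\<^sup>2 * ln ((norm z)\<^sup>2))"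
    and integral_gauss_inner_ln:
      "(\<integral>z. (z \<bullet> a)\<^sup>2 * ln ((norm z)\<^sup>2) \<partial>gauss) = erlang_ent k / (2 * (real k + 1))"
proof -
  have int: "integrable gauss (\<lambda>z. (z \<bullet> b)\<^sup>2 * ln ((norm z)\<^sup>2))" if "norm b = 1" for b :: 'a
  proof (rule Bochner_Integration.integrable_bound[OF integrable_gauss_norm_sq_ln[OF D]])
    show "AE z in gauss. norm ((z \<bullet> b)\<^sup>2 * ln ((norm z)\<^sup>2)) \<le> norm ((norm z)\<^sup>2 * ln ((norm z)\<^sup>2))"
    proof (rule AE_I2)
      fix z :: 'a
      have "\<bar>z \<bullet> b\<bar> \<le> norm z" using Cauchy_Schwarz_ineq2[of z b] that by simp
      then have "(z \<bullet> b)\<^sup>2 \<le> (norm z)\<^sup>2" by (metis abs_le_square_iff abs_norm_cancel)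
      then show "norm ((z \<bullet> b)\<^sup>2 * ln ((norm z)\<^sup>2)) \<le> norm ((norm z)\<^sup>2 * ln ((norm z)\<^sup>2))"
        by (simp add: abs_mult mult_right_mono)
    qed
  qed measurable
  show "integrable gauss (\<lambda>z. (z \<bullet> a)\<^sup>2 * ln ((norm z)\<^sup>2))" by (rule int[OF a])
  define q where "q b = (\<integral>z. (z \<bullet> b)\<^sup>2 * ln ((norm z)\<^sup>2) \<partial>gauss)" for b :: 'a
  have q: "q b = q a" if b: "norm b = 1" for b
  proof -
    let ?T = "reflection (a - b)"
    have [measurable]: "?T \<in> borel_measurable borel" unfolding reflection_def[abs_def] by measurable
    have "q a = (\<integral>z. (z \<bullet> a)\<^sup>2 * ln ((norm z)\<^sup>2) \<partial>distr gauss borel ?T)"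
      by (subst distr_gauss_reflection) (simp_all add: D q_def)
    also have "\<dots> = (\<integral>z. (?T z \<bullet> a)\<^sup>2 * ln ((norm (?T z))\<^sup>2) \<partial>gauss)"
      by (rule integral_distr) measurable
    also have "\<dots> = q b"
      using a b by (simp add: q_def norm_reflection inner_reflection)
    finally show ?thesis ..
  qed
  have "erlang_ent k = (\<integral>z. (\<Sum>b\<in>Basis. (z \<bullet> b)\<^sup>2 * ln ((norm z)\<^sup>2)) \<partial>(gauss::'a measure))"
  proof -
    have eq: "(\<Sum>b\<in>Basis. (z \<bullet> b)\<^sup>2) = (norm z)\<^sup>2" for z :: 'a
      unfolding power2_norm_eq_inner by (subst (2) euclidean_inner) (simp add: power2_eq_square)
    show ?thesis
      unfolding integral_gauss_norm_sq_ln[OF D, symmetric] sum_distrib_right[symmetric] eq ..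
  qed
  also have "\<dots> = (\<Sum>b\<in>(Basis::'a set). q b)"
    unfolding q_def by (rule Bochner_Integration.integral_sum) (simp add: int)
  also have "\<dots> = (\<Sum>b\<in>(Basis::'a set). q a)"
    by (intro sum.cong q) auto
  also have "\<dots> = 2 * (real k + 1) * q a" by (simp add: D)
  finally show "(\<integral>z. (z \<bullet> a)\<^sup>2 * ln ((norm z)\<^sup>2) \<partial>gauss) = erlang_ent k / (2 * (real k + 1))"
    by (simp add: q_def field_simps)
qed

lemma Re_Im_cinner:
  "Re (cinner v z) = z \<bullet> v" "Im (cinner v z) = z \<bullet> (\<i> *s v)"
  by (simp_all add: cinner_def inner_vec_def inner_complex_def algebra_simps)

lemma cmod_cinner_sq: "(cmod (cinner v z))\<^sup>2 = (z \<bullet> v)\<^sup>2 + (z \<bullet> (\<i> *s v))\<^sup>2"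
  by (simp add: cmod_power2 Re_Im_cinner)

lemma norm_scale: "norm (c *s v) = cmod c * norm v" for v :: "complex ^ 'n::finite"
proof -
  have "(norm (c *s v))\<^sup>2 = (cmod c * norm v)\<^sup>2"
    unfolding power_mult_distrib
    by (simp add: norm_vec_def L2_set_def sum_nonneg norm_mult power_mult_distrib sum_distrib_left)
  then show ?thesis by (simp only: power2_eq_iff_nonneg norm_ge_zero mult_nonneg_nonneg)
qed

text \<open>Pythagoras: adding a multiple of \<phi> to z leaves the part orthogonal to \<phi>
  unchanged, and the squared length of that part is |z|^2 - |\<langle>\<phi>,z\<rangle>|^2.\<close>

lemma distr_gauss_cinner:
  fixes \<phi> :: "complex ^ 'n::finite"
  assumes "norm \<phi> = 1"
  shows "distr gauss borel (cinner \<phi>) = gauss"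
proof (rule distr_gauss[where S = "\<lambda>w. w *s \<phi>"])
  show "cinner \<phi> \<in> borel_measurable borel"
    unfolding cinner_def[abs_def] by (intro borel_measurable_continuous_onI continuous_intros)
  have s: "cinner \<phi> \<phi> = 1" using assms by (simp add: cinner_self)
  fix z w
  show "cinner \<phi> (z + w *s \<phi>) = cinner \<phi> z + w"
    by (simp add: cinner_add_right cinner_scale_right s)
  have "of_real ((norm (z + w *s \<phi>))\<^sup>2 - (norm (cinner \<phi> z + w))\<^sup>2) =
      (of_real ((norm z)\<^sup>2 - (norm (cinner \<phi> z))\<^sup>2) :: complex)"
    unfolding of_real_diff cinner_self[symmetric] complex_norm_square
    by (simp add: cinner_add_right cinner_add_left cinner_scale_left cinner_scale_right s
        cinner_commute[of z \<phi>] algebra_simps)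
  then show "(norm (z + w *s \<phi>))\<^sup>2 - (norm (cinner \<phi> z + w))\<^sup>2 = (norm z)\<^sup>2 - (norm (cinner \<phi> z))\<^sup>2"
    by (simp only: of_real_eq_iff)
qed simp_all

text \<open>The price of replacing p by an upper bound a inside a logarithm with prefactor p. At p =
  0 the outer factor makes it 0.\<close>

definition ent :: "real \<Rightarrow> real \<Rightarrow> real" where
  "ent p a = p * ln (a / p)"

lemma ent_nonneg: "0 \<le> p \<Longrightarrow> p \<le> a \<Longrightarrow> 0 \<le> ent p a"
  unfolding ent_def by (cases "p = 0") (auto intro!: mult_nonneg_nonneg)

lemma ent_scale: "c > 0 \<Longrightarrow> ent (c * p) (c * a) = c * ent p a"
  by (simp add: ent_def)

lemma measurable_ent [measurable (raw)]:
  assumes [measurable]: "f \<in> borel_measurable M" "g \<in> borel_measurable M"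
  shows "(\<lambda>x. ent (f x) (g x)) \<in> borel_measurable M"
  unfolding ent_def by measurable

lemma measurable_cinner [measurable (raw)]:
  assumes "f \<in> borel_measurable M" "g \<in> borel_measurable M"
  shows "(\<lambda>x. cinner (f x) (g x)) \<in> borel_measurable M"
proof -
  have "continuous_on UNIV (\<lambda>(v, w). cinner v (w :: complex ^ 'n::finite))"
    unfolding cinner_def split_beta' by (intro continuous_intros)
  from borel_measurable_continuous_on[OF this, of "\<lambda>x. (f x, g x)" M] assms show ?thesis
    by (simp add: borel_prod[symmetric])
qed

definition harmonic_tail :: "nat \<Rightarrow> real" where
  "harmonic_tail d = (\<Sum>n=2..d. 1 / real n)"

lemma harmonic_tail_nonneg: "0 \<le> harmonic_tail d"
  unfolding harmonic_tail_def by (intro sum_nonneg) simp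

lemma nn_integral_gauss_ent:
  fixes v :: "complex ^ 'n::finite"
  shows "(\<integral>\<^sup>+z. ennreal (ent ((cmod (cinner v z))\<^sup>2) ((norm v)\<^sup>2 * (norm z)\<^sup>2)) \<partial>gauss) =
    ennreal (harmonic_tail CARD('n) * (norm v)\<^sup>2)"
proof (cases "v = 0")
  case True
  then show ?thesis by (simp add: ent_def cinner_def)
next
  case False
  define \<phi> where "\<phi> = complex_of_real (1 / norm v) *s v"
  have \<phi>: "norm \<phi> = 1" using False by (simp add: \<phi>_def norm_scale norm_divide)
  have v: "v = complex_of_real (norm v) *s \<phi>" using False by (simp add: \<phi>_def vec_eq_iff)
  obtain k where k: "CARD('n) = Suc k" using not0_implies_Suc[of "CARD('n)"] by auto
  have D: "DIM(complex ^ 'n) = 2 * Suc k" by (simp add: k)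
  have D1: "DIM(complex) = 2 * Suc 0" by simp
  let ?X = "\<lambda>z. (cmod (cinner \<phi> z))\<^sup>2"
  \<comment> \<open>The overlap with a unit vector is a standard Gaussian on the complex line, which
    is the case k = 0 of the radial integrals.\<close>
  have 1: "integrable gauss (\<lambda>z. ?X z * ln (?X z))" "(\<integral>z. ?X z * ln (?X z) \<partial>gauss) = erlang_ent 0"
  proof -
    have [measurable]: "cinner \<phi> \<in> borel_measurable borel" by measurable
    have "integrable (distr gauss borel (cinner \<phi>)) (\<lambda>w. (norm w)\<^sup>2 * ln ((norm w)\<^sup>2))"
      "(\<integral>w. (norm w)\<^sup>2 * ln ((norm w)\<^sup>2) \<partial>distr gauss borel (cinner \<phi>)) = erlang_ent 0"
      unfolding distr_gauss_cinner[OF \<phi>]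
      by (rule integrable_gauss_norm_sq_ln[OF D1] integral_gauss_norm_sq_ln[OF D1])+
    then show "integrable gauss (\<lambda>z. ?X z * ln (?X z))" "(\<integral>z. ?X z * ln (?X z) \<partial>gauss) = erlang_ent 0"
      by (simp_all add: integrable_distr_eq integral_distr)
  qed
  have i\<phi>: "norm (\<i> *s \<phi>) = 1" by (simp add: norm_scale \<phi>)
  \<comment> \<open>The squared overlap splits into the real directions \<phi> and i \<phi>, each of
    which contributes half.\<close>
  have 2: "integrable gauss (\<lambda>z. ?X z * ln ((norm z)\<^sup>2))"
      "(\<integral>z. ?X z * ln ((norm z)\<^sup>2) \<partial>gauss) = erlang_ent k / (real k + 1)"
    unfolding cmod_cinner_sq distrib_right
    using integrable_gauss_inner_ln[OF D \<phi>] integrable_gauss_inner_ln[OF D i\<phi>]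
    by (simp_all add: integral_gauss_inner_ln[OF D \<phi>] integral_gauss_inner_ln[OF D i\<phi>] divide_simps)
  have X: "?X z \<le> (norm z)\<^sup>2" for z
    using cmod_cinner_le[of \<phi> z] by (simp add: \<phi> power_mono)
  have e: "ent (?X z) ((norm z)\<^sup>2) = ?X z * ln ((norm z)\<^sup>2) - ?X z * ln (?X z)" for z
  proof (cases "?X z = 0")
    case False
    then have "z \<noteq> 0" by (auto simp: cinner_def)
    with False show ?thesis
      by (simp add: ent_def ln_div right_diff_distrib del: power_eq_0_iff zero_less_power2)
  qed (simp add: ent_def)
  have "integrable gauss (\<lambda>z. ent (?X z) ((norm z)\<^sup>2))"
    and "(\<integral>z. ent (?X z) ((norm z)\<^sup>2) \<partial>gauss) = harmonic_tail CARD('n)"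
    unfolding e using 1 2 erlang_ent_eq[of k] by (simp_all add: harmonic_tail_def k)
  then have *: "(\<integral>\<^sup>+z. ennreal (ent (?X z) ((norm z)\<^sup>2)) \<partial>gauss) = ennreal (harmonic_tail CARD('n))"
    by (subst nn_integral_eq_integral) (auto intro!: ent_nonneg X)
  have "ent ((cmod (cinner v z))\<^sup>2) ((norm v)\<^sup>2 * (norm z)\<^sup>2) = (norm v)\<^sup>2 * ent (?X z) ((norm z)\<^sup>2)" for z
  proof -
    have "(cmod (cinner v z))\<^sup>2 = (norm v)\<^sup>2 * ?X z"
      by (subst v) (simp add: cinner_scale_left norm_mult power_mult_distrib)
    then show ?thesis using False by (simp add: ent_scale)
  qed
  then have "(\<integral>\<^sup>+z. ennreal (ent ((cmod (cinner v z))\<^sup>2) ((norm v)\<^sup>2 * (norm z)\<^sup>2)) \<partial>gauss) =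
      (\<integral>\<^sup>+z. ennreal ((norm v)\<^sup>2) * ennreal (ent (?X z) ((norm z)\<^sup>2)) \<partial>gauss)"
    by (simp add: ennreal_mult')
  also have "\<dots> = ennreal ((norm v)\<^sup>2) * (\<integral>\<^sup>+z. ennreal (ent (?X z) ((norm z)\<^sup>2)) \<partial>gauss)"
    by (rule nn_integral_cmult) measurable
  finally show ?thesis
    by (simp add: * ennreal_mult harmonic_tail_nonneg mult.commute)
qed

section \<open>Unitarily invariant measures\<close>

text \<open>The complex analogue of \<open>reflection\<close>. Division by zero yields 0, so
  \<open>householder 0\<close> is the identity, and \<open>householder_swap\<close> includes the
  case a = b.\<close>

definition householder :: "complex ^ 'n::finite \<Rightarrow> 'n operator" where
  "householder v = (\<chi> i j. (if i = j then 1 else 0) - 2 * v $ i * cnj (v $ j) / of_real ((norm v)\<^sup>2))"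

lemma householder_mult:
  "householder v *v x = x - (2 * cinner v x / of_real ((norm v)\<^sup>2)) *s v"
proof -
  let ?c = "2 / complex_of_real ((norm v)\<^sup>2)"
  have e: "householder v $ i $ j * x $ j = (if i = j then x $ j else 0) - ?c * v $ i * (cnj (v $ j) * x $ j)" for i j
    by (simp add: householder_def left_diff_distrib)
  have "(householder v *v x) $ i = x $ i - ?c * v $ i * cinner v x" for i
    unfolding cinner_def matrix_vector_mult_def vec_lambda_beta e sum_subtractf sum_distrib_left[symmetric]
    by (simp only: sum.delta' finite UNIV_I if_True)
  then show ?thesis by (simp add: vec_eq_iff mult_ac)
qed

lemma cinner_diff_left: "cinner (u - v) w = cinner u w - cinner v w"
  by (simp add: cinner_def sum_subtractf algebra_simps)

lemma cinner_diff_right: "cinner w (u - v) = cinner w u - cinner w v"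
  by (simp add: cinner_def sum_subtractf algebra_simps)

lemma cinner_householder: "cinner x (householder v *v y) = cinner (householder v *v x) y"
  by (simp add: householder_mult cinner_diff_left cinner_diff_right cinner_scale_left
      cinner_scale_right cinner_commute[of x v])

lemma householder_involution: "householder v *v (householder v *v x) = x"
proof (cases "v = 0")
  case False
  then have "cinner v v \<noteq> 0" by (simp add: cinner_self)
  then show ?thesis
    by (simp add: householder_mult cinner_diff_right cinner_scale_right vec_eq_iff cinner_self[symmetric]
        del: of_real_power)
qed (simp add: householder_mult)

lemma unitary_householder: "unitary (householder v)"
proof -
  have "conj_transpose (householder v) = householder v"
    by (simp add: conj_transpose_def householder_def vec_eq_iff mult_ac)
  moreover have "householder v ** householder v = mat 1"
    unfolding matrix_eq by (simp add: matrix_vector_mul_assoc[symmetric] householder_involution)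
  ultimately show ?thesis by (simp add: unitary_def)
qed

text \<open>Over the complex numbers a reflection along a - b exchanges two unit vectors only if
  their overlap is real, which is what the last assumption expresses.\<close>

lemma householder_swap:
  assumes "norm a = 1" "norm b = 1" "cinner a b = cinner b a"
  shows "householder (a - b) *v a = b"
proof (cases "a = b")
  case False
  then have "cinner (a - b) (a - b) \<noteq> 0" by (simp add: cinner_self)
  moreover have "cinner a a = 1" "cinner b b = 1"
    using assms by (simp_all add: cinner_self)
  then have "cinner (a - b) (a - b) = 2 * cinner (a - b) a"
    using assms(3) by (simp add: cinner_diff_left cinner_diff_right)
  ultimately show ?thesis
    by (simp add: householder_mult cinner_self[symmetric] del: of_real_power)
qed (simp add: householder_mult)

lemma norm_unitary: "unitary U \<Longrightarrow> norm (U *v x) = norm x"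
proof -
  assume U: "unitary U"
  have adj: "cinner (U *v x) y = cinner x (conj_transpose U *v y)" for x y
    by (simp add: cinner_def matrix_vector_mult_def conj_transpose_def sum_distrib_left sum_distrib_right)
       (subst sum.swap, simp add: mult_ac)
  have "cinner (U *v x) (U *v x) = cinner x x"
    using U by (simp add: adj matrix_vector_mul_assoc unitary_def)
  then have "(norm (U *v x))\<^sup>2 = (norm x)\<^sup>2"
    unfolding cinner_self of_real_eq_iff .
  then show ?thesis by (simp only: power2_eq_iff_nonneg norm_ge_zero)
qed

context
  fixes \<mu> :: "(complex ^ 'n::finite) measure"
  assumes haar: "haar_on_unit_vectors \<mu>"
begin

lemma sets_haar: "sets \<mu> = sets unit_vectors"
  using haar by (simp add: haar_on_unit_vectors_def)

lemma space_haar: "space \<mu> = sphere 0 1"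
  using sets_eq_imp_space_eq[OF sets_haar] by (simp add: unit_vectors_def space_restrict_space)

lemma measurable_haar: "f \<in> borel_measurable borel \<Longrightarrow> f \<in> borel_measurable \<mu>"
  by (subst measurable_cong_sets[OF sets_haar refl])
     (simp add: unit_vectors_def measurable_restrict_space1)

lemma nn_integral_haar_unitary:
  assumes U: "unitary U" and f: "f \<in> borel_measurable borel"
  shows "(\<integral>\<^sup>+\<psi>. f (U *v \<psi>) \<partial>\<mu>) = (\<integral>\<^sup>+\<psi>. f \<psi> \<partial>\<mu>)"
proof -
  have "continuous_on UNIV (\<lambda>v. U *v v)"
    unfolding matrix_vector_mult_def by (intro continuous_intros)
  then have "(\<lambda>v. U *v v) \<in> borel_measurable borel"
    by (rule borel_measurable_continuous_onI)
  then have m: "(\<lambda>v. U *v v) \<in> measurable \<mu> unit_vectors"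
    unfolding unit_vectors_def
    by (intro measurable_restrict_space2) (auto simp: space_haar norm_unitary[OF U] intro: measurable_haar)
  have "(\<integral>\<^sup>+\<psi>. f \<psi> \<partial>\<mu>) = (\<integral>\<^sup>+\<psi>. f \<psi> \<partial>distr \<mu> unit_vectors (\<lambda>v. U *v v))"
    using haar U by (simp add: haar_on_unit_vectors_def)
  also have "\<dots> = (\<integral>\<^sup>+\<psi>. f (U *v \<psi>) \<partial>\<mu>)"
    using f by (intro nn_integral_distr[OF m]) (simp add: unit_vectors_def measurable_restrict_space1)
  finally show ?thesis ..
qed

text \<open>A phase factor does not change the modulus of the overlap, so b may be rotated until its
  overlap with a is real; then one Householder reflection carries a to b.\<close>

lemma nn_integral_haar_overlap:
  fixes f :: "real \<Rightarrow> ennreal"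
  assumes a: "norm a = 1" and b: "norm b = 1" and [measurable]: "f \<in> borel_measurable borel"
  shows "(\<integral>\<^sup>+\<psi>. f (cmod (cinner a \<psi>)) \<partial>\<mu>) = (\<integral>\<^sup>+\<psi>. f (cmod (cinner b \<psi>)) \<partial>\<mu>)"
proof -
  define c where "c = (if cinner a b = 0 then 1 else cnj (cinner a b) / cmod (cinner a b))"
  have c: "cmod c = 1" by (simp add: c_def norm_divide)
  have b': "norm (c *s b) = 1" by (simp add: norm_scale b c)
  have "cinner a (c *s b) = of_real (cmod (cinner a b))"
    by (simp add: c_def cinner_scale_right complex_norm_square[symmetric] power2_eq_square mult.commute)
  then have sym: "cinner a (c *s b) = cinner (c *s b) a"
    by (subst (2) cinner_commute) simp
  let ?U = "householder (a - c *s b)"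
  have "(\<integral>\<^sup>+\<psi>. f (cmod (cinner a \<psi>)) \<partial>\<mu>) = (\<integral>\<^sup>+\<psi>. f (cmod (cinner a (?U *v \<psi>))) \<partial>\<mu>)"
    by (rule nn_integral_haar_unitary[OF unitary_householder, symmetric]) measurable
  also have "\<dots> = (\<integral>\<^sup>+\<psi>. f (cmod (cinner (c *s b) \<psi>)) \<partial>\<mu>)"
    unfolding cinner_householder householder_swap[OF a b' sym] ..
  also have "\<dots> = (\<integral>\<^sup>+\<psi>. f (cmod (cinner b \<psi>)) \<partial>\<mu>)"
    by (simp add: cinner_scale_left norm_mult c)
  finally show ?thesis .
qed

text \<open>
  By invariance the inner integral over \<open>\<mu>\<close> is the same for all directions of the Gaussian
  vector, and the iterated integral in the other order is \<open>nn_integral_gauss_ent\<close>.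
\<close>

lemma nn_integral_haar_ent:
  "(\<integral>\<^sup>+\<psi>. ennreal (ent ((cmod (cinner v \<psi>))\<^sup>2) ((norm v)\<^sup>2)) \<partial>\<mu>) =
    ennreal (harmonic_tail CARD('n) / CARD('n) * (norm v)\<^sup>2)"
proof -
  interpret \<mu>: prob_space \<mu> using haar by (simp add: haar_on_unit_vectors_def)
  interpret \<gamma>: prob_space "gauss :: (complex ^ 'n) measure"
    by (rule prob_space_gauss) simp
  interpret pair_sigma_finite \<mu> "gauss :: (complex ^ 'n) measure" ..
  let ?d = "CARD('n)" and ?h = "harmonic_tail CARD('n)"
  define G where "G v = (\<integral>\<^sup>+\<psi>. ennreal (ent ((cmod (cinner v \<psi>))\<^sup>2) ((norm v)\<^sup>2)) \<partial>\<mu>)" for v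
  obtain e :: "complex ^ 'n" where e: "norm e = 1"
    using vector_choose_size[of 1] by auto
  \<comment> \<open>Homogeneity of \<open>ent\<close> takes out the squared norm, and invariance
    makes the remaining value independent of the direction.\<close>
  have G: "G v = G e * ennreal ((norm v)\<^sup>2)" for v
  proof (cases "v = 0")
    case True
    then show ?thesis by (simp add: G_def ent_def cinner_def)
  next
    case False
    define u where "u = complex_of_real (1 / norm v) *s v"
    have u: "norm u = 1" using False by (simp add: u_def norm_scale norm_divide)
    have v: "v = complex_of_real (norm v) *s u" using False by (simp add: u_def vec_eq_iff)
    have "ent ((cmod (cinner v \<psi>))\<^sup>2) ((norm v)\<^sup>2) = (norm v)\<^sup>2 * ent ((cmod (cinner u \<psi>))\<^sup>2) 1" for \<psi>
    proof -
      have "(cmod (cinner v \<psi>))\<^sup>2 = (norm v)\<^sup>2 * (cmod (cinner u \<psi>))\<^sup>2"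
        by (subst v) (simp add: cinner_scale_left norm_mult power_mult_distrib)
      then show ?thesis using False ent_scale[of "(norm v)\<^sup>2" _ 1] by simp
    qed
    then have "G v = (\<integral>\<^sup>+\<psi>. ennreal ((norm v)\<^sup>2) * ennreal (ent ((cmod (cinner u \<psi>))\<^sup>2) 1) \<partial>\<mu>)"
      by (simp add: G_def ennreal_mult')
    also have "\<dots> = ennreal ((norm v)\<^sup>2) * (\<integral>\<^sup>+\<psi>. ennreal (ent ((cmod (cinner u \<psi>))\<^sup>2) 1) \<partial>\<mu>)"
      by (rule nn_integral_cmult) (intro measurable_haar, measurable)
    also have "(\<integral>\<^sup>+\<psi>. ennreal (ent ((cmod (cinner u \<psi>))\<^sup>2) 1) \<partial>\<mu>) = G e"
      unfolding G_def e
      using nn_integral_haar_overlap[OF u e, of "\<lambda>x. ennreal (ent (x\<^sup>2) 1)"] by simp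
    finally show ?thesis by (simp add: mult.commute)
  qed
  \<comment> \<open>The measure \<mu> lives on the sphere as a subspace, so its points have to be
    read as vectors of the whole space before Fubini applies.\<close>
  have [measurable]: "fst \<in> borel_measurable (\<mu> \<Otimes>\<^sub>M (gauss :: (complex ^ 'n) measure))"
    by (rule measurable_compose[OF measurable_fst measurable_haar]) simp
  obtain k where k: "?d = Suc k" using not0_implies_Suc[of ?d] by auto
  have D: "DIM(complex ^ 'n) = 2 * Suc k" by (simp add: k)
  have "ennreal ?h = (\<integral>\<^sup>+\<psi>. ennreal ?h \<partial>\<mu>)"
    by (simp add: \<mu>.emeasure_space_1)
  also have "\<dots> = (\<integral>\<^sup>+\<psi>. (\<integral>\<^sup>+z. ennreal (ent ((cmod (cinner \<psi> z))\<^sup>2) ((norm \<psi>)\<^sup>2 * (norm z)\<^sup>2)) \<partial>gauss) \<partial>\<mu>)"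
  proof (rule nn_integral_cong)
    fix \<psi> assume "\<psi> \<in> space \<mu>"
    then have "norm \<psi> = 1" by (simp add: space_haar)
    then show "ennreal ?h = (\<integral>\<^sup>+z. ennreal (ent ((cmod (cinner \<psi> z))\<^sup>2) ((norm \<psi>)\<^sup>2 * (norm z)\<^sup>2)) \<partial>gauss)"
      using nn_integral_gauss_ent[of \<psi>] by simp
  qed
  also have "\<dots> = (\<integral>\<^sup>+z. (\<integral>\<^sup>+\<psi>. ennreal (ent ((cmod (cinner \<psi> z))\<^sup>2) ((norm \<psi>)\<^sup>2 * (norm z)\<^sup>2)) \<partial>\<mu>) \<partial>gauss)"
    by (rule Fubini'[symmetric]) measurable
  also have "\<dots> = (\<integral>\<^sup>+z. G z \<partial>gauss)"
    unfolding G_def by (intro nn_integral_cong) (simp add: space_haar cmod_cinner_commute)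
  also have "\<dots> = (\<integral>\<^sup>+z. G e * ennreal ((norm z)\<^sup>2) \<partial>(gauss :: (complex ^ 'n) measure))"
    by (rule nn_integral_cong) (rule G)
  also have "\<dots> = G e * (\<integral>\<^sup>+z. ennreal ((norm z)\<^sup>2) \<partial>(gauss :: (complex ^ 'n) measure))"
    by (rule nn_integral_cmult) measurable
  also have "(\<integral>\<^sup>+z. ennreal ((norm z)\<^sup>2) \<partial>(gauss :: (complex ^ 'n) measure)) = ennreal ?d"
    using integral_gauss_norm_sq[OF D] integrable_gauss_norm_sq[OF D]
    by (subst nn_integral_eq_integral) (simp_all add: k)
  finally have "ennreal ?h * ennreal (1 / ?d) = G e * (ennreal ?d * ennreal (1 / ?d))"
    by (simp add: mult.assoc)
  then have Ge: "G e = ennreal (?h / ?d)"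
    by (simp add: ennreal_mult'[symmetric] harmonic_tail_nonneg)
  have "G v = G e * ennreal ((norm v)\<^sup>2)" by (rule G)
  also have "\<dots> = ennreal (?h / ?d * (norm v)\<^sup>2)"
    unfolding Ge by (rule ennreal_mult[symmetric]) (simp_all add: harmonic_tail_nonneg)
  finally show ?thesis unfolding G_def .
qed

end

text \<open>The index measure has total mass d and the Haar law is the image of its d-th part; this
  factor d cancels the 1/d of \<open>nn_integral_haar_ent\<close>.\<close>

lemma scrooge_ent:
  fixes P :: "real \<Rightarrow> 'n::finite operator"
  assumes "scrooge_povm N P"
  shows "(\<integral>\<^sup>+y. ennreal (ent (Re (trace (ketbra v ** P y))) ((norm v)\<^sup>2)) \<partial>N) =
    ennreal (harmonic_tail CARD('n) * (norm v)\<^sup>2)"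
proof -
  let ?d = "CARD('n)"
  let ?S = "scale_measure (ennreal (1 / real ?d)) N"
  from assms obtain \<psi> where \<psi>: "\<psi> \<in> measurable N unit_vectors"
    and haar: "haar_on_unit_vectors (distr ?S unit_vectors \<psi>)"
    and P: "\<And>y. y \<in> space N \<Longrightarrow> P y = ketbra (\<psi> y)"
    unfolding scrooge_povm_def by blast
  let ?f = "\<lambda>\<psi>. ennreal (ent ((cmod (cinner v \<psi>))\<^sup>2) ((norm v)\<^sup>2))"
  have \<psi>': "\<psi> \<in> measurable ?S unit_vectors"
    using \<psi> by (subst measurable_cong_sets[OF sets_scale_measure refl])
  have f: "?f \<in> borel_measurable unit_vectors"
    unfolding unit_vectors_def by (rule measurable_restrict_space1) measurable
  have "ennreal (harmonic_tail ?d / ?d * (norm v)\<^sup>2) = (\<integral>\<^sup>+\<psi>. ?f \<psi> \<partial>distr ?S unit_vectors \<psi>)"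
    using nn_integral_haar_ent[OF haar] by simp
  also have "\<dots> = (\<integral>\<^sup>+y. ?f (\<psi> y) \<partial>?S)"
    by (rule nn_integral_distr[OF \<psi>']) (use f in simp)
  also have "\<dots> = ennreal (1 / ?d) * (\<integral>\<^sup>+y. ?f (\<psi> y) \<partial>N)"
    by (rule nn_integral_scale_measure) (rule measurable_compose[OF \<psi> f])
  finally have "ennreal ?d * ennreal (harmonic_tail ?d / ?d * (norm v)\<^sup>2) =
      (ennreal ?d * ennreal (1 / ?d)) * (\<integral>\<^sup>+y. ?f (\<psi> y) \<partial>N)"
    by (simp add: mult.assoc)
  then have "(\<integral>\<^sup>+y. ?f (\<psi> y) \<partial>N) = ennreal (harmonic_tail ?d * (norm v)\<^sup>2)"
    by (simp add: ennreal_mult'[symmetric])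
  moreover have "(\<integral>\<^sup>+y. ennreal (ent (Re (trace (ketbra v ** P y))) ((norm v)\<^sup>2)) \<partial>N) = (\<integral>\<^sup>+y. ?f (\<psi> y) \<partial>N)"
    by (rule nn_integral_cong) (simp add: P trace_ketbra_ketbra del: of_real_power)
  ultimately show ?thesis by simp
qed

section \<open>Mutual information of an ensemble and a POVM\<close>

lemma sigma_finite_lebesgue: "sigma_finite_measure (lebesgue :: 'a::euclidean_space measure)"
proof
  obtain A :: "'a set set" where A: "countable A" "A \<subseteq> sets lborel" "\<Union>A = space lborel"
      "\<forall>a\<in>A. emeasure lborel a \<noteq> \<infinity>"
    using lborel.sigma_finite_countable by blast
  show "\<exists>A::'a set set. countable A \<and> A \<subseteq> sets lebesgue \<and> \<Union>A = space lebesgue \<and>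
      (\<forall>a\<in>A. emeasure lebesgue a \<noteq> \<infinity>)"
    using A by (intro exI[of _ A]) (auto simp: subset_iff)
qed

lemma sigma_finite_index:
  assumes "discrete_index M \<or> continuous_index M"
  shows "sigma_finite_measure M"
  using assms sigma_finite_measure_restrict_space[OF sigma_finite_lebesgue]
  by (auto simp: discrete_index_def continuous_index_def sigma_finite_measure_count_space_countable)

section \<open>The trace pairing as a bounded linear and measurable operation\<close>

lemma bounded_linear_trace_mult_left: "bounded_linear (\<lambda>A. Re (trace (A ** (B :: 'n::finite operator))))"
proof -
  have "linear (\<lambda>A. Re (trace (A ** B)))"
    by (rule linearI)
       (simp_all add: trace_def matrix_matrix_mult_def sum.distrib algebra_simps scaleR_sum_right sum_distrib_left)
  then show ?thesis by (simp add: linear_conv_bounded_linear)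
qed

lemma bounded_linear_trace_mult_right: "bounded_linear (\<lambda>A. Re (trace ((B :: 'n::finite operator) ** A)))"
  using bounded_linear_trace_mult_left[of B] by (simp only: trace_mul_sym[of B])

lemma bounded_linear_Re_trace: "bounded_linear (\<lambda>A :: 'n::finite operator. Re (trace A))"
  using bounded_linear_trace_mult_left[of "mat 1"] by simp

lemma Re_trace_scaleR: "Re (trace (c *\<^sub>R A)) = c * Re (trace A)" for A :: "'n::finite operator"
  using linear_scale[OF bounded_linear.linear[OF bounded_linear_Re_trace]] by simp

lemma Re_trace_scaleR_mult: "Re (trace ((c *\<^sub>R A) ** B)) = c * Re (trace (A ** B))"
  for A :: "'n::finite operator"
  using linear_scale[OF bounded_linear.linear[OF bounded_linear_trace_mult_left]] by simp

lemma measurable_trace_mult [measurable (raw)]: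
  fixes A B :: "'a \<Rightarrow> 'n::finite operator"
  assumes "A \<in> borel_measurable M" "B \<in> borel_measurable M"
  shows "(\<lambda>x. Re (trace (A x ** B x))) \<in> borel_measurable M"
proof -
  have "continuous_on UNIV (\<lambda>(A, B). Re (trace (A ** (B :: 'n operator))))"
    unfolding trace_def matrix_matrix_mult_def split_beta' by (simp, intro continuous_intros)
  from borel_measurable_continuous_on[OF this, of "\<lambda>x. (A x, B x)" M] assms show ?thesis
    by (simp add: borel_prod[symmetric])
qed

lemma measurable_trace [measurable (raw)]:
  "A \<in> borel_measurable M \<Longrightarrow> (\<lambda>x. Re (trace (A x :: 'n::finite operator))) \<in> borel_measurable M"
  using measurable_trace_mult[of A M "\<lambda>_. mat 1"] by simp

text \<open>The last assumption guards against the default value \<open>p / 0 = 0\<close>, for which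
  the right side would be 0.\<close>

lemma mult_ln_ge:
  fixes p r :: real
  assumes "0 \<le> r" "0 \<le> p" "p > 0 \<Longrightarrow> r > 0"
  shows "p - r \<le> p * ln (p / r)"
proof (cases "p = 0")
  case False
  with assms(2,3) have pr: "p > 0" "r > 0" by auto
  then have "ln (r / p) \<le> r / p - 1" by (intro ln_le_minus_one) simp
  then have "p * (1 - r / p) \<le> p * ln (p / r)"
    using pr by (intro mult_left_mono) (simp_all add: ln_div)
  then show ?thesis using pr by (simp add: right_diff_distrib)
qed (use assms(1) in simp)

locale ensemble_povm =
  fixes M N :: "real measure" and \<rho> P :: "real \<Rightarrow> 'n::finite operator" and d :: real
  assumes ensemble: "ensemble M \<rho>" and povm: "povm N P" and d: "d = real CARD('n)"
begin

abbreviation "p \<equiv> joint_prob \<rho> P"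
abbreviation "a \<equiv> input_prob \<rho>"
abbreviation "q \<equiv> output_prob M \<rho> P"
abbreviation "t y \<equiv> Re (trace (P y))"
abbreviation "MN \<equiv> M \<Otimes>\<^sub>M N"

lemma d_ge_1: "d \<ge> 1"
  by (simp add: d Suc_le_eq)

sublocale M: sigma_finite_measure M
  using ensemble by (simp add: ensemble_def sigma_finite_index)

sublocale N: sigma_finite_measure N
  using povm by (simp add: povm_def sigma_finite_index)

sublocale MN: pair_sigma_finite M N ..

lemma measurable_ensemble [measurable]: "\<rho> \<in> borel_measurable M"
  using ensemble by (simp add: ensemble_def)

lemma measurable_povm [measurable]: "P \<in> borel_measurable N"
  using povm by (simp add: povm_def)

lemma psd_ensemble: "x \<in> space M \<Longrightarrow> psd (\<rho> x)"
  using ensemble by (simp add: ensemble_def state_def)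

lemma psd_povm: "y \<in> space N \<Longrightarrow> psd (P y)"
  using povm by (simp add: povm_def effect_def)

lemma measurable_joint [measurable]: "(\<lambda>z. p (fst z) (snd z)) \<in> borel_measurable MN"
  unfolding joint_prob_def by measurable

lemma measurable_input [measurable]: "a \<in> borel_measurable M"
  unfolding input_prob_def[abs_def] by measurable

lemma measurable_output [measurable]: "q \<in> borel_measurable N"
  unfolding output_prob_def[abs_def] by measurable

lemma measurable_info [measurable]: "(\<lambda>z. info_term M \<rho> P (fst z) (snd z)) \<in> borel_measurable MN"
  unfolding info_term_def by measurable

lemma input_nonneg: "x \<in> space M \<Longrightarrow> 0 \<le> a x"
  using trace_psd[OF psd_ensemble] by (simp add: input_prob_def)

lemma t_nonneg: "y \<in> space N \<Longrightarrow> 0 \<le> t y"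
  using trace_psd[OF psd_povm] by simp

lemma joint_nonneg: "x \<in> space M \<Longrightarrow> y \<in> space N \<Longrightarrow> 0 \<le> p x y"
  unfolding joint_prob_def by (intro trace_mult_psd psd_ensemble psd_povm)

lemma joint_le: "x \<in> space M \<Longrightarrow> y \<in> space N \<Longrightarrow> p x y \<le> a x * t y"
  unfolding joint_prob_def input_prob_def by (intro trace_mult_psd psd_ensemble psd_povm)

lemma has_integral_input: "has_bochner_integral M a 1"
proof -
  have "has_bochner_integral M (\<lambda>x. trace (\<rho> x)) 1"
    using ensemble by (simp add: ensemble_def)
  from has_bochner_integral_bounded_linear[OF bounded_linear_Re this] show ?thesis
    by (simp add: input_prob_def[abs_def])
qed

lemma integrable_ensemble: "integrable M \<rho>"
proof (rule Bochner_Integration.integrable_bound)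
  show "integrable M a" using has_integral_input by (simp add: has_bochner_integral_iff)
  show "AE x in M. norm (\<rho> x) \<le> norm (a x)"
    using norm_psd_le[OF psd_ensemble] input_nonneg by (intro AE_I2) (simp add: input_prob_def)
qed measurable

lemma integrable_povm: "integrable N P" and integral_povm: "integral\<^sup>L N P = mat 1"
  using povm by (auto simp: povm_def has_bochner_integral_iff)

lemma trace_mat_1: "trace (mat 1 :: 'n operator) = of_nat CARD('n)"
  by (simp add: trace_def mat_def)

lemma has_integral_t: "has_bochner_integral N t d"
  using integrable_bounded_linear[OF bounded_linear_Re_trace integrable_povm]
    integral_bounded_linear[OF bounded_linear_Re_trace integrable_povm]
  by (simp add: has_bochner_integral_iff integral_povm trace_mat_1 d)

lemma has_integral_joint_fst: "has_bochner_integral M (\<lambda>x. p x y) (q y)"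
  using integrable_bounded_linear[OF bounded_linear_trace_mult_left integrable_ensemble, of "P y"]
    integral_bounded_linear[OF bounded_linear_trace_mult_left integrable_ensemble, of "P y"]
  by (simp add: has_bochner_integral_iff joint_prob_def output_prob_def average_state_def)

lemma Re_trace_average_state: "Re (trace (average_state M \<rho>)) = 1"
  using integral_bounded_linear[OF bounded_linear_Re_trace integrable_ensemble] has_integral_input
  by (simp add: has_bochner_integral_iff average_state_def input_prob_def[abs_def])

lemma has_integral_output: "has_bochner_integral N q 1"
  using integrable_bounded_linear[OF bounded_linear_trace_mult_right integrable_povm, of "average_state M \<rho>"]
    integral_bounded_linear[OF bounded_linear_trace_mult_right integrable_povm, of "average_state M \<rho>"]
  by (simp add: has_bochner_integral_iff output_prob_def[abs_def] integral_povm Re_trace_average_state)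

lemma output_nonneg: "y \<in> space N \<Longrightarrow> 0 \<le> q y"
proof -
  assume y: "y \<in> space N"
  have "0 \<le> (\<integral>x. p x y \<partial>M)" using joint_nonneg y by (intro integral_nonneg_AE AE_I2)
  then show ?thesis using has_integral_joint_fst[of y] by (simp add: has_bochner_integral_iff)
qed

lemma nn_integral_joint_fst: "y \<in> space N \<Longrightarrow> (\<integral>\<^sup>+x. ennreal (p x y) \<partial>M) = ennreal (q y)"
  using has_integral_joint_fst[of y] joint_nonneg
  by (subst nn_integral_eq_integral) (auto simp: has_bochner_integral_iff)

lemma nn_integral_input: "(\<integral>\<^sup>+x. ennreal (a x) \<partial>M) = 1"
  using has_integral_input input_nonneg
  by (subst nn_integral_eq_integral) (auto simp: has_bochner_integral_iff)

lemma nn_integral_output: "(\<integral>\<^sup>+y. ennreal (q y) \<partial>N) = 1"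
  using has_integral_output output_nonneg
  by (subst nn_integral_eq_integral) (auto simp: has_bochner_integral_iff)

lemma nn_integral_t: "(\<integral>\<^sup>+y. ennreal (t y) \<partial>N) = ennreal d"
  using has_integral_t t_nonneg
  by (subst nn_integral_eq_integral) (auto simp: has_bochner_integral_iff)

text \<open>A weight depending on the outcome alone sees only the marginal. It is used for the total
  mass, for the null set where q vanishes, and for the quotient t/q.\<close>

lemma nn_integral_joint_weight:
  assumes [measurable]: "w \<in> borel_measurable N"
  shows "(\<integral>\<^sup>+z. ennreal (p (fst z) (snd z)) * w (snd z) \<partial>MN) = (\<integral>\<^sup>+y. ennreal (q y) * w y \<partial>N)"
proof -
  have "(\<integral>\<^sup>+z. ennreal (p (fst z) (snd z)) * w (snd z) \<partial>MN) = (\<integral>\<^sup>+y. (\<integral>\<^sup>+x. ennreal (p x y) * w y \<partial>M) \<partial>N)"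
    by (subst MN.nn_integral_snd[symmetric]) simp_all
  also have "\<dots> = (\<integral>\<^sup>+y. ennreal (q y) * w y \<partial>N)"
  proof (rule nn_integral_cong)
    fix y assume y: "y \<in> space N"
    then have "(\<lambda>x. p x y) \<in> borel_measurable M" unfolding joint_prob_def by measurable
    then show "(\<integral>\<^sup>+x. ennreal (p x y) * w y \<partial>M) = ennreal (q y) * w y"
      using nn_integral_joint_fst[OF y] by (simp add: nn_integral_multc)
  qed
  finally show ?thesis .
qed

lemma has_integral_joint: "has_bochner_integral MN (\<lambda>z. p (fst z) (snd z)) 1"
proof (rule has_bochner_integral_nn_integral)
  show "(\<integral>\<^sup>+z. ennreal (p (fst z) (snd z)) \<partial>MN) = ennreal 1"
    using nn_integral_joint_weight[of "\<lambda>_. 1"] nn_integral_output by simp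
qed (auto simp: space_pair_measure joint_nonneg)

lemma has_integral_product: "has_bochner_integral MN (\<lambda>z. a (fst z) * q (snd z)) 1"
proof (rule has_bochner_integral_nn_integral)
  have "(\<integral>\<^sup>+z. ennreal (a (fst z) * q (snd z)) \<partial>MN) = (\<integral>\<^sup>+x. (\<integral>\<^sup>+y. ennreal (a x * q y) \<partial>N) \<partial>M)"
    by (subst N.nn_integral_fst[symmetric]) simp_all
  also have "\<dots> = (\<integral>\<^sup>+x. (\<integral>\<^sup>+y. ennreal (a x) * ennreal (q y) \<partial>N) \<partial>M)"
    by (intro nn_integral_cong) (simp add: ennreal_mult input_nonneg output_nonneg)
  also have "\<dots> = ennreal 1"
    by (simp add: nn_integral_cmult nn_integral_output nn_integral_input)
  finally show "(\<integral>\<^sup>+z. ennreal (a (fst z) * q (snd z)) \<partial>MN) = ennreal 1" .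
qed (auto simp: space_pair_measure input_nonneg output_nonneg)

text \<open>If q(y) = 0, then p(x,y) vanishes only for almost every x, hence the exceptional set:
  its p-mass is the integral of q over the zeros of q. Positivity of a and t follows pointwise from
  p \<le> a t.\<close>

lemma AE_joint_pos:
  "AE z in MN. p (fst z) (snd z) > 0 \<longrightarrow> a (fst z) > 0 \<and> t (snd z) > 0 \<and> q (snd z) > 0"
proof -
  have "(\<integral>\<^sup>+z. ennreal (p (fst z) (snd z)) * indicator {0} (q (snd z)) \<partial>MN) =
      (\<integral>\<^sup>+y. ennreal (q y) * indicator {0} (q y) \<partial>N)"
    by (rule nn_integral_joint_weight) measurable
  also have "\<dots> = 0"
    by (subst nn_integral_0_iff_AE) (auto split: split_indicator)
  finally have "AE z in MN. ennreal (p (fst z) (snd z)) * indicator {0} (q (snd z)) = 0"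
    by (subst (asm) nn_integral_0_iff_AE) simp_all
  then show ?thesis
  proof (rule AE_mp, intro AE_I2 impI)
    fix z assume z: "z \<in> space MN" and 0: "ennreal (p (fst z) (snd z)) * indicator {0} (q (snd z)) = 0"
      and pos: "p (fst z) (snd z) > 0"
    from z have s: "fst z \<in> space M" "snd z \<in> space N" by (auto simp: space_pair_measure)
    have "q (snd z) \<noteq> 0" using 0 pos by (auto split: split_indicator_asm)
    moreover have "a (fst z) * t (snd z) > 0" using joint_le[OF s] pos by linarith
    ultimately show "a (fst z) > 0 \<and> t (snd z) > 0 \<and> q (snd z) > 0"
      using output_nonneg[OF s(2)] input_nonneg[OF s(1)] t_nonneg[OF s(2)]
      by (auto simp: zero_less_mult_iff)
  qed
qed

section \<open>Integrable bounds for the information density and comparison through deficits\<close>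

abbreviation "f z \<equiv> info_term M \<rho> P (fst z) (snd z)"

lemma info_term_ln2: "info_term M \<rho> P x y * ln 2 = p x y * ln (p x y / (a x * q y))"
  by (simp add: info_term_def log_def)

text \<open>The logarithm in p ln (t/q) is linearised at q = t/d, the outcome density of the average
  state 1/d. Integrability then comes from p and t alone.\<close>

definition u :: "real \<times> real \<Rightarrow> real" where
  "u z = p (fst z) (snd z) * (ln d + t (snd z) / (q (snd z) * d) - 1)"

lemma u_upper:
  assumes "p x y > 0" "t y > 0" "q y > 0"
  shows "p x y * ln (t y / q y) \<le> u (x, y)"
proof -
  have "ln (t y / (q y * d)) \<le> t y / (q y * d) - 1"
    using assms d_ge_1 by (intro ln_le_minus_one) simp
  moreover have "ln (t y / q y) = ln d + ln (t y / (q y * d))"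
    using assms d_ge_1 by (simp add: ln_div ln_mult)
  ultimately have "ln (t y / q y) \<le> ln d + t y / (q y * d) - 1" by simp
  then show ?thesis using assms(1) by (simp add: u_def mult_left_mono)
qed

lemma integrable_u: "integrable MN u" and integral_u: "integral\<^sup>L MN u \<le> ln d"
proof -
  let ?w = "\<lambda>z. p (fst z) (snd z) * (t (snd z) / (q (snd z) * d))"
  have nn: "0 \<le> ?w z" if "z \<in> space MN" for z
    using that d_ge_1 by (intro mult_nonneg_nonneg divide_nonneg_nonneg)
      (auto simp: space_pair_measure joint_nonneg output_nonneg t_nonneg)
  have "(\<integral>\<^sup>+z. ennreal (?w z) \<partial>MN) = (\<integral>\<^sup>+z. ennreal (p (fst z) (snd z)) * ennreal (t (snd z) / (q (snd z) * d)) \<partial>MN)"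
    by (intro nn_integral_cong ennreal_mult') (auto simp: space_pair_measure joint_nonneg)
  also have "\<dots> = (\<integral>\<^sup>+y. ennreal (q y) * ennreal (t y / (q y * d)) \<partial>N)"
    by (rule nn_integral_joint_weight) measurable
  also have "\<dots> \<le> (\<integral>\<^sup>+y. ennreal (1 / d) * ennreal (t y) \<partial>N)"
  proof (rule nn_integral_mono)
    fix y assume y: "y \<in> space N"
    \<comment> \<open>Only an inequality: where q y = 0 the quotient takes the default value 0,
      while t y may be positive.\<close>
    have "q y * (t y / (q y * d)) \<le> 1 / d * t y"
      using t_nonneg[OF y] d_ge_1 by (cases "q y = 0") auto
    then show "ennreal (q y) * ennreal (t y / (q y * d)) \<le> ennreal (1 / d) * ennreal (t y)"
      using d_ge_1 output_nonneg[OF y] by (simp add: ennreal_mult'[symmetric] ennreal_leI)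
  qed
  also have "\<dots> = ennreal (1 / d) * ennreal d"
    by (simp add: nn_integral_cmult nn_integral_t)
  also have "\<dots> = 1" using d_ge_1 by (simp add: ennreal_mult'[symmetric])
  finally have le: "(\<integral>\<^sup>+z. ennreal (?w z) \<partial>MN) \<le> 1" .
  have int: "integrable MN ?w"
    using nn le by (intro integrableI_nonneg) (auto simp: top_unique less_top[symmetric])
  have "ennreal (integral\<^sup>L MN ?w) \<le> 1"
    using le nn_integral_eq_integral[OF int] nn by (simp add: AE_I2)
  then have le1: "integral\<^sup>L MN ?w \<le> 1" by (simp add: ennreal_le_1)
  have e: "u z = p (fst z) (snd z) * (ln d - 1) + ?w z" for z
    by (simp add: u_def algebra_simps)
  have p: "integrable MN (\<lambda>z. p (fst z) (snd z))" "(\<integral>z. p (fst z) (snd z) \<partial>MN) = 1"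
    using has_integral_joint by (auto simp: has_bochner_integral_iff)
  show "integrable MN u"
    unfolding e[abs_def] using p int by simp
  have "integral\<^sup>L MN u = ln d - 1 + integral\<^sup>L MN ?w"
    unfolding e[abs_def] using p int by simp
  then show "integral\<^sup>L MN u \<le> ln d" using le1 by simp
qed

lemma info_ge: "AE z in MN. p (fst z) (snd z) - a (fst z) * q (snd z) \<le> f z * ln 2"
  using AE_joint_pos
proof (rule AE_mp, intro AE_I2 impI)
  fix z assume "z \<in> space MN"
    and *: "p (fst z) (snd z) > 0 \<longrightarrow> a (fst z) > 0 \<and> t (snd z) > 0 \<and> q (snd z) > 0"
  then have s: "fst z \<in> space M" "snd z \<in> space N" by (auto simp: space_pair_measure)
  show "p (fst z) (snd z) - a (fst z) * q (snd z) \<le> f z * ln 2"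
    unfolding info_term_ln2
    using * s by (intro mult_ln_ge) (auto simp: joint_nonneg input_nonneg output_nonneg)
qed

lemma info_le: "AE z in MN. f z * ln 2 \<le> u z"
  using AE_joint_pos
proof (rule AE_mp, intro AE_I2 impI)
  fix z assume "z \<in> space MN"
    and *: "p (fst z) (snd z) > 0 \<longrightarrow> a (fst z) > 0 \<and> t (snd z) > 0 \<and> q (snd z) > 0"
  obtain x y where z: "z = (x, y)" by (cases z)
  with \<open>z \<in> space MN\<close> have s: "x \<in> space M" "y \<in> space N" by (auto simp: space_pair_measure)
  show "f z * ln 2 \<le> u z"
  proof (cases "p x y = 0")
    case True
    then show ?thesis by (simp add: z info_term_def u_def)
  next
    case False
    then have pos: "p x y > 0" "a x > 0" "t y > 0" "q y > 0"
      using * joint_nonneg[OF s] by (auto simp: z)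
    have "p x y / (a x * q y) \<le> (a x * t y) / (a x * q y)"
      using pos by (intro divide_right_mono joint_le s) simp
    also have "\<dots> = t y / q y" using pos by simp
    finally have "ln (p x y / (a x * q y)) \<le> ln (t y / q y)"
      using pos by (subst ln_le_cancel_iff) auto
    then have "p x y * ln (p x y / (a x * q y)) \<le> p x y * ln (t y / q y)"
      using pos by (intro mult_left_mono) auto
    also have "\<dots> \<le> u (x, y)" using pos by (intro u_upper)
    finally show ?thesis by (simp only: z info_term_ln2 fst_conv snd_conv)
  qed
qed

text \<open>The density lies between two integrable functions. Hence the mutual information is
  always a real number and the extended difference defining it is never \<infinity> -
  \<infinity>.\<close>

lemma integrable_info: "integrable MN f"
proof -
  let ?l = "\<lambda>z. p (fst z) (snd z) - a (fst z) * q (snd z)"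
  have l: "integrable MN ?l"
    using has_integral_joint has_integral_product by (auto simp: has_bochner_integral_iff)
  have "integrable MN (\<lambda>z. f z * ln 2)"
  proof (rule Bochner_Integration.integrable_bound)
    show "integrable MN (\<lambda>z. \<bar>u z\<bar> + \<bar>?l z\<bar>)" using integrable_u l by simp
    show "AE z in MN. norm (f z * ln 2) \<le> norm (\<bar>u z\<bar> + \<bar>?l z\<bar>)"
      using info_ge info_le by eventually_elim auto
  qed measurable
  then show ?thesis by simp
qed

lemma mutual_info_eq: "mutual_info M \<rho> N P = ereal (integral\<^sup>L MN f)"
proof -
  have fin: "(\<integral>\<^sup>+z. ennreal (f z) \<partial>MN) < \<infinity>" "(\<integral>\<^sup>+z. ennreal (- f z) \<partial>MN) < \<infinity>"
    using integrable_info by (auto simp: real_integrable_def less_top)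
  have e: "enn2ereal x = ereal (enn2real x)" if "x < \<infinity>" for x
    using that by (cases x) auto
  show ?thesis
    unfolding mutual_info_def split_beta'
    by (simp add: e[OF fin(1)] e[OF fin(2)] real_lebesgue_integral_def[OF integrable_info])
qed

lemma mutual_info_nonneg: "0 \<le> mutual_info M \<rho> N P"
proof -
  have "0 = (\<integral>z. p (fst z) (snd z) - a (fst z) * q (snd z) \<partial>MN)"
    using has_integral_joint has_integral_product by (auto simp: has_bochner_integral_iff)
  also have "\<dots> \<le> (\<integral>z. f z * ln 2 \<partial>MN)"
    using has_integral_joint has_integral_product integrable_info
    by (intro integral_mono_AE info_ge) (auto simp: has_bochner_integral_iff)
  finally show ?thesis by (simp add: mutual_info_eq zero_le_mult_iff)
qed

text \<open>Here g is a guaranteed pointwise loss against the majorant \<open>u\<close>. A lower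
  bound on its nonnegative integral suffices, since its integrability follows from 0 \<le> g \<le> u
  - f ln 2.\<close>

lemma mutual_info_le_deficit:
  assumes g: "g \<in> borel_measurable MN" "AE z in MN. 0 \<le> g z" "AE z in MN. f z * ln 2 + g z \<le> u z"
    and c: "0 \<le> c" "ennreal c \<le> (\<integral>\<^sup>+z. ennreal (g z) \<partial>MN)"
  shows "mutual_info M \<rho> N P \<le> ereal ((ln d - c) / ln 2)"
proof -
  have int: "integrable MN (\<lambda>z. u z - f z * ln 2)" using integrable_u integrable_info by simp
  have ig: "integrable MN g"
  proof (rule Bochner_Integration.integrable_bound[OF int])
    show "AE z in MN. norm (g z) \<le> norm (u z - f z * ln 2)"
      using g(2,3) by eventually_elim auto
  qed (rule g(1))
  have "ennreal c \<le> ennreal (integral\<^sup>L MN g)"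
    using c(2) nn_integral_eq_integral[OF ig g(2)] by simp
  then have "c \<le> integral\<^sup>L MN g"
    using g(2) by (simp add: ennreal_le_iff integral_nonneg_AE)
  also have "\<dots> \<le> (\<integral>z. u z - f z * ln 2 \<partial>MN)"
    using g(3) by (intro integral_mono_AE ig int) auto
  also have "\<dots> = integral\<^sup>L MN u - integral\<^sup>L MN f * ln 2"
    using integrable_u integrable_info by simp
  finally have "integral\<^sup>L MN f * ln 2 \<le> ln d - c" using integral_u by simp
  then show ?thesis by (simp add: mutual_info_eq field_simps)
qed

lemma mutual_info_le: "mutual_info M \<rho> N P \<le> ereal (log 2 d)"
  using mutual_info_le_deficit[of "\<lambda>_. 0" 0] info_le by (simp add: log_def)

text \<open>The counterpart in the other direction: g bounds the shortfall of the density from p ln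
  d, so it must account for the gap between ln d and any bound on the information. Stated in
  \<open>ennreal\<close>, it covers an infinite integral of g and can be integrated over a family of
  ensembles.\<close>

lemma deficit_ge:
  assumes g: "g \<in> borel_measurable MN" "AE z in MN. 0 \<le> g z"
      "AE z in MN. p (fst z) (snd z) * ln d \<le> f z * ln 2 + g z"
    and w: "mutual_info M \<rho> N P \<le> ereal w"
  shows "ennreal (ln d - w * ln 2) \<le> (\<integral>\<^sup>+z. ennreal (g z) \<partial>MN)"
proof (cases "(\<integral>\<^sup>+z. ennreal (g z) \<partial>MN) = \<infinity>")
  case False
  then have ig: "integrable MN g"
    using g by (intro integrableI_nonneg) (auto simp: less_top[symmetric])
  have "ln d = (\<integral>z. p (fst z) (snd z) * ln d \<partial>MN)"
    using has_integral_joint by (auto simp: has_bochner_integral_iff)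
  also have "\<dots> \<le> (\<integral>z. f z * ln 2 + g z \<partial>MN)"
    using has_integral_joint integrable_info ig
    by (intro integral_mono_AE g(3)) (auto simp: has_bochner_integral_iff)
  also have "\<dots> = integral\<^sup>L MN f * ln 2 + integral\<^sup>L MN g"
    using integrable_info ig by simp
  also have "integral\<^sup>L MN f * ln 2 \<le> w * ln 2"
    using w by (simp add: mutual_info_eq)
  finally have "ln d - w * ln 2 \<le> integral\<^sup>L MN g" by simp
  then show ?thesis
    using nn_integral_eq_integral[OF ig g(2)] by (simp add: ennreal_leI)
qed simp

end

section \<open>Finite ensembles\<close>

text \<open>The log sum inequality. Each logarithm is bounded by its tangent at the ratio T/S of the
  sums, and the linear corrections add up to zero.\<close>

lemma ent_sum_le:
  assumes "finite K" and p: "\<And>k. k \<in> K \<Longrightarrow> 0 \<le> p k" and pa: "\<And>k. k \<in> K \<Longrightarrow> p k \<le> a k"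
  shows "(\<Sum>k\<in>K. ent (p k) (a k)) \<le> ent (\<Sum>k\<in>K. p k) (\<Sum>k\<in>K. a k)"
proof (cases "(\<Sum>k\<in>K. p k) = 0")
  case True
  then have "p k = 0" if "k \<in> K" for k
    using that assms by (simp add: sum_nonneg_eq_0_iff)
  then show ?thesis by (simp add: ent_def)
next
  case False
  define S T where "S = (\<Sum>k\<in>K. p k)" and "T = (\<Sum>k\<in>K. a k)"
  have "0 \<le> S" "S \<le> T" unfolding S_def T_def using p pa by (auto intro: sum_nonneg sum_mono)
  with False have ST: "S > 0" "T > 0" by (auto simp: S_def)
  have "ent (p k) (a k) \<le> p k * ln (T / S) + (a k * (S / T) - p k)" if k: "k \<in> K" for k
  proof (cases "p k = 0")
    case True
    then show ?thesis using ST pa[OF k] by (simp add: ent_def)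
  next
    case False
    then have pos: "p k > 0" "a k > 0" using p[OF k] pa[OF k] by auto
    have "ln (a k / p k) - ln (T / S) = ln ((a k / p k) * (S / T))"
      using pos ST by (simp add: ln_div ln_mult)
    also have "\<dots> \<le> (a k / p k) * (S / T) - 1"
      using pos ST by (intro ln_le_minus_one) simp
    finally have "p k * (ln (a k / p k) - ln (T / S)) \<le> p k * ((a k / p k) * (S / T) - 1)"
      using pos by (intro mult_left_mono) auto
    then show ?thesis using pos by (simp add: ent_def algebra_simps)
  qed
  then have "(\<Sum>k\<in>K. ent (p k) (a k)) \<le> (\<Sum>k\<in>K. p k * ln (T / S) + (a k * (S / T) - p k))"
    by (rule sum_mono)
  also have "\<dots> = S * ln (T / S) + (T * (S / T) - S)"
    by (simp only: sum.distrib sum_subtractf sum_distrib_right[symmetric] S_def T_def)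
  finally show ?thesis using ST by (simp add: ent_def S_def T_def)
qed

lemma psd_sum: "(\<And>k. k \<in> K \<Longrightarrow> psd (A k)) \<Longrightarrow> psd (\<Sum>k\<in>K. A k)"
proof (induction K rule: infinite_finite_induct)
  case (insert k K)
  then show ?case
    by (simp add: psd_def matrix_vector_mult_add_rdistrib cinner_add_right)
qed (simp_all add: psd_def cinner_def)

lemma psd_ketbra: "psd (ketbra v)"
  by (simp add: psd_def cinner_ketbra del: of_real_power)

lemma scaleR_ketbra: "0 \<le> c \<Longrightarrow> c *\<^sub>R ketbra v = ketbra (of_real (sqrt c) *s v)"
proof -
  assume "0 \<le> c"
  then have "complex_of_real (sqrt c) * of_real (sqrt c) = of_real c"
    by (simp flip: of_real_mult)
  then have "c *\<^sub>R (x * y) = (of_real (sqrt c) * x) * (of_real (sqrt c) * y)" for x y :: complex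
    by (simp add: scaleR_conv_of_real mult_ac)
  then show ?thesis by (simp add: ketbra_def vec_eq_iff)
qed

section \<open>Families over finite index sets and orthonormal bases\<close>

lemma ensemble_count_space:
  assumes X: "finite X" "\<And>x. x \<in> X \<Longrightarrow> psd (\<rho> x)" "(\<Sum>x\<in>X. trace (\<rho> x)) = 1"
  shows "ensemble (count_space X) \<rho>" "average_state (count_space X) \<rho> = (\<Sum>x\<in>X. \<rho> x)"
proof -
  have "Re (trace (\<rho> x)) \<le> 1" if "x \<in> X" for x
  proof -
    have "Re (trace (\<rho> x)) \<le> (\<Sum>x\<in>X. Re (trace (\<rho> x)))"
      using X trace_psd that by (intro member_le_sum) auto
    also have "\<dots> = 1" using X(3) by (simp flip: Re_sum)
    finally show ?thesis .
  qed
  moreover have "discrete_index (count_space X)"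
    unfolding discrete_index_def using X(1) countable_finite by blast
  ultimately show "ensemble (count_space X) \<rho>"
    using X by (auto simp: ensemble_def state_def
        has_bochner_integral_iff integrable_count_space lebesgue_integral_count_space_finite)
  show "average_state (count_space X) \<rho> = (\<Sum>x\<in>X. \<rho> x)"
    by (simp add: average_state_def lebesgue_integral_count_space_finite X)
qed

lemma povm_count_space:
  assumes Y: "finite Y" "\<And>y. y \<in> Y \<Longrightarrow> psd (P y)" "(\<Sum>y\<in>Y. P y) = mat 1"
  shows "povm (count_space Y) P"
proof -
  have "psd (mat 1 - P y)" if "y \<in> Y" for y
  proof -
    have "mat 1 - P y = (\<Sum>y'\<in>Y - {y}. P y')"
      using Y that by (simp add: sum.remove[of Y y] flip: Y(3))
    then show ?thesis using Y(2) by (auto intro: psd_sum)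
  qed
  moreover have "discrete_index (count_space Y)"
    unfolding discrete_index_def using Y(1) countable_finite by blast
  ultimately show ?thesis
    using Y by (auto simp: povm_def effect_def
        has_bochner_integral_iff integrable_count_space lebesgue_integral_count_space_finite)
qed

lemma sum_matrix_vector_mult: "(\<Sum>k\<in>K. A k) *v x = (\<Sum>k\<in>K. A k *v x)"
  for A :: "'k \<Rightarrow> 'n::finite operator"
  by (induction K rule: infinite_finite_induct) (simp_all add: matrix_vector_mult_add_rdistrib)

lemma ketbra_mult_vec: "ketbra v *v x = cinner v x *s v"
  by (simp add: ketbra_def matrix_vector_mult_def cinner_def vec_eq_iff sum_distrib_left mult_ac)

text \<open>The vectors fixed by the sum of the projections form a subspace that contains the basis,
  hence everything.\<close>

lemma orthonormal_basis_resolution: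
  assumes I: "finite I" and e: "orthonormal_basis I e"
  shows "(\<Sum>i\<in>I. ketbra (e i)) = mat 1"
proof -
  let ?R = "\<lambda>x. \<Sum>i\<in>I. cinner (e i) x *s e i"
  have "?R x = x" for x
  proof (rule vec.span_induct[of x "e ` I"])
    show "x \<in> vec.span (e ` I)" using e by (simp add: orthonormal_basis_def)
    show "vec.subspace {x. ?R x = x}"
      unfolding vec.subspace_def
    proof (intro conjI ballI allI)
      show "0 \<in> {x. ?R x = x}" by (simp add: cinner_def)
      show "x + y \<in> {x. ?R x = x}" if "x \<in> {x. ?R x = x}" "y \<in> {x. ?R x = x}" for x y
      proof -
        have "?R (x + y) = ?R x + ?R y"
          by (simp add: vec_eq_iff cinner_add_right distrib_right sum.distrib)
        then show ?thesis using that by simp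
      qed
      show "c *s x \<in> {x. ?R x = x}" if "x \<in> {x. ?R x = x}" for c x
      proof -
        have "?R (c *s x) = c *s ?R x"
          by (simp add: vec_eq_iff cinner_scale_right sum_distrib_left mult.assoc)
        then show ?thesis using that by simp
      qed
    qed
    fix x assume "x \<in> e ` I"
    then obtain j where j: "j \<in> I" "x = e j" by auto
    have "?R x = (\<Sum>i\<in>I. if i = j then e i else 0)"
      using e j by (intro sum.cong) (auto simp: orthonormal_basis_def)
    then show "?R x = x" using I j by simp
  qed
  then show ?thesis
    unfolding matrix_eq by (simp add: sum_matrix_vector_mult ketbra_mult_vec)
qed

lemma orthonormal_basis_norm: "orthonormal_basis I e \<Longrightarrow> i \<in> I \<Longrightarrow> norm (e i) = 1"
proof -
  assume "orthonormal_basis I e" "i \<in> I"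
  then have "complex_of_real ((norm (e i))\<^sup>2) = of_real 1"
    unfolding cinner_self[symmetric] by (simp add: orthonormal_basis_def)
  then have "(norm (e i))\<^sup>2 = 1" by (simp only: of_real_eq_iff)
  then show ?thesis by (simp add: power2_eq_1_iff) (smt (verit) norm_ge_zero)
qed

section \<open>Signed permutations of the coordinates\<close>

definition signed_perm :: "('n \<Rightarrow> bool) \<times> ('n \<Rightarrow> 'n) \<Rightarrow> complex ^ 'n::finite \<Rightarrow> complex ^ 'n" where
  "signed_perm g z = (\<chi> i. if fst g i then - (z $ snd g i) else z $ snd g i)"

definition signed_perms :: "(('n::finite \<Rightarrow> bool) \<times> ('n \<Rightarrow> 'n)) set" where
  "signed_perms = {g. bij (snd g)}"

lemma norm_sq_sum: "(norm v)\<^sup>2 = (\<Sum>i\<in>UNIV. (cmod (v $ i))\<^sup>2)" for v :: "complex ^ 'n::finite"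
  by (simp add: norm_vec_def L2_set_def sum_nonneg)

lemma norm_signed_perm: "g \<in> signed_perms \<Longrightarrow> norm (signed_perm g z) = norm z"
proof -
  assume "g \<in> signed_perms"
  then have "(\<Sum>i\<in>UNIV. (cmod (z $ snd g i))\<^sup>2) = (\<Sum>i\<in>UNIV. (cmod (z $ i))\<^sup>2)"
    by (intro sum.reindex_bij_betw) (simp add: signed_perms_def)
  then have "(norm (signed_perm g z))\<^sup>2 = (norm z)\<^sup>2"
    unfolding norm_sq_sum by (simp add: signed_perm_def if_distrib[of cmod] cong: if_cong)
  then show ?thesis by (simp only: power2_eq_iff_nonneg norm_ge_zero)
qed

text \<open>The adjoint of a signed permutation is its inverse. It moves the group element from the
  Gaussian vector to the vector of the effect, whose norm is all that the Gaussian average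
  sees.\<close>

lemma signed_perm_adjoint:
  assumes g: "g \<in> signed_perms"
  obtains w' where "norm w' = norm w" "\<And>z. cinner (signed_perm g z) w = cinner z w'"
proof
  let ?\<sigma> = "inv (snd g)"
  let ?w = "\<chi> j. if fst g (?\<sigma> j) then - (w $ ?\<sigma> j) else w $ ?\<sigma> j"
  have b: "bij (snd g)" using g by (simp add: signed_perms_def)
  show "cinner (signed_perm g z) w = cinner z ?w" for z
  proof -
    have "cinner z ?w = (\<Sum>i\<in>UNIV. cnj (z $ snd g i) * ?w $ snd g i)"
      unfolding cinner_def by (rule sum.reindex_bij_betw[symmetric]) (rule b)
    then show ?thesis
      using b by (auto simp: cinner_def signed_perm_def bij_is_inj inv_f_f intro!: sum.cong)
  qed
  have "?w = signed_perm (fst g \<circ> ?\<sigma>, ?\<sigma>) w"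
    by (simp add: signed_perm_def cong: if_cong)
  moreover have "(fst g \<circ> ?\<sigma>, ?\<sigma>) \<in> signed_perms"
    using bij_imp_bij_inv[OF b] by (simp add: signed_perms_def)
  ultimately show "norm ?w = norm w" by (simp add: norm_signed_perm)
qed

text \<open>This finite group is large enough to imitate averaging over all unitaries: sign changes
  remove the off-diagonal entries and permutations equalise the diagonal ones, so the sum is scalar
  and its trace determines it.\<close>

lemma signed_perm_frame:
  fixes z :: "complex ^ 'n::finite"
  shows "(\<Sum>g\<in>signed_perms. ketbra (signed_perm g z)) =
    (real (card (signed_perms :: (('n \<Rightarrow> bool) \<times> ('n \<Rightarrow> 'n)) set)) * (norm z)\<^sup>2 / real CARD('n)) *\<^sub>R mat 1"
proof -
  let ?G = "signed_perms :: (('n \<Rightarrow> bool) \<times> ('n \<Rightarrow> 'n)) set"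
  define E where "E i j = (\<Sum>g\<in>?G. ketbra (signed_perm g z) $ i $ j)" for i j
  have off: "E i j = 0" if "i \<noteq> j" for i j
  proof -
    \<comment> \<open>Flipping the sign of coordinate i is an involution of the group that negates
      entry (i, j).\<close>
    let ?h = "\<lambda>g :: ('n \<Rightarrow> bool) \<times> ('n \<Rightarrow> 'n). ((fst g)(i := \<not> fst g i), snd g)"
    have "E i j = (\<Sum>g\<in>?G. - (ketbra (signed_perm g z) $ i $ j))"
      unfolding E_def
      by (rule sum.reindex_bij_witness[of _ ?h ?h])
         (use that in \<open>auto simp: signed_perms_def ketbra_def signed_perm_def\<close>)
    then show ?thesis by (simp add: E_def sum_negf)
  qed
  have diag_g: "ketbra (signed_perm g z) $ i $ i = of_real ((cmod (z $ snd g i))\<^sup>2)" for g i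
    by (simp add: ketbra_def signed_perm_def complex_norm_square del: of_real_power)
  have diag: "E i i = E j j" for i j
  proof -
    \<comment> \<open>Composing with the transposition of i and j exchanges the two diagonal
      entries.\<close>
    let ?h = "\<lambda>g :: ('n \<Rightarrow> bool) \<times> ('n \<Rightarrow> 'n). (fst g, snd g \<circ> Transposition.transpose i j)"
    show ?thesis
      unfolding E_def diag_g
      by (rule sum.reindex_bij_witness[of _ ?h ?h])
         (auto simp: signed_perms_def comp_assoc bij_comp transpose_apply_first)
  qed
  have "of_nat CARD('n) * E i i = (\<Sum>j\<in>UNIV. E j j)" for i
  proof -
    have "(\<Sum>j\<in>UNIV. E j j) = (\<Sum>j\<in>(UNIV :: 'n set). E i i)"
      by (rule sum.cong[OF refl]) (rule diag)
    then show ?thesis by simp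
  qed
  also have "(\<Sum>j\<in>UNIV. E j j) = (\<Sum>g\<in>?G. \<Sum>j\<in>UNIV. of_real ((cmod (z $ snd g j))\<^sup>2))"
    unfolding E_def diag_g by (rule sum.swap)
  also have "\<dots> = (\<Sum>g\<in>?G. of_real ((norm z)\<^sup>2))"
  proof (rule sum.cong)
    fix g assume "g \<in> ?G"
    then have "(\<Sum>i\<in>UNIV. (cmod (z $ snd g i))\<^sup>2) = (\<Sum>i\<in>UNIV. (cmod (z $ i))\<^sup>2)"
      by (intro sum.reindex_bij_betw) (simp add: signed_perms_def)
    then show "(\<Sum>j\<in>UNIV. of_real ((cmod (z $ snd g j))\<^sup>2)) = complex_of_real ((norm z)\<^sup>2)"
      unfolding norm_sq_sum of_real_sum[symmetric] by simp
  qed simp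
  finally have "E i i = of_real (real (card ?G) * (norm z)\<^sup>2 / real CARD('n))" for i
    by (simp add: field_simps)
  then have E: "E i j = (if i = j then of_real (real (card ?G) * (norm z)\<^sup>2 / real CARD('n)) else 0)" for i j
    using off by auto
  have "(\<Sum>g\<in>?G. ketbra (signed_perm g z)) $ i $ j = E i j" for i j
    by (simp add: E_def)
  then show ?thesis
    unfolding vec_eq_iff E by (simp add: mat_def scaleR_conv_of_real[where 'a = complex])
qed

section \<open>Bounds and their attainment\<close>

lemma measurable_ketbra [measurable (raw)]:
  assumes "v \<in> borel_measurable M"
  shows "(\<lambda>x. ketbra (v x :: complex ^ 'n::finite)) \<in> borel_measurable M"
proof -
  have "continuous_on UNIV (ketbra :: complex ^ 'n \<Rightarrow> _)"
    unfolding ketbra_def by (intro continuous_intros)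
  from borel_measurable_continuous_on[OF this assms] show ?thesis .
qed

lemma measurable_signed_perm [measurable]:
  "(signed_perm g :: complex ^ 'n::finite \<Rightarrow> _) \<in> borel_measurable borel"
proof -
  have "continuous_on UNIV (\<lambda>z. (if b then - (z $ i) else z $ i) :: complex)" for b and i :: 'n
    by (cases b) (auto intro!: continuous_intros)
  then show ?thesis
    unfolding signed_perm_def[abs_def] by (intro borel_measurable_continuous_onI continuous_intros)
qed

lemma (in ensemble_povm) scrooge_mutual_info_le:
  assumes "scrooge_povm N P"
  shows "mutual_info M \<rho> N P \<le> ereal ((ln d - harmonic_tail CARD('n)) / ln 2)"
proof (rule mutual_info_le_deficit[where g = "\<lambda>z. ent (p (fst z) (snd z)) (a (fst z))"])
  let ?h = "harmonic_tail CARD('n)"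
  \<comment> \<open>Scrooge effects have unit trace, so p \<le> a and the deficit ent p (a t) is
    simply ent p a.\<close>
  have t: "t y = 1" if "y \<in> space N" for y
  proof -
    obtain \<psi> where \<psi>: "\<psi> \<in> measurable N unit_vectors" "\<forall>y\<in>space N. P y = ketbra (\<psi> y)"
      using assms unfolding scrooge_povm_def by blast
    have "\<psi> y \<in> sphere 0 1"
      using measurable_space[OF \<psi>(1) that] by (simp add: unit_vectors_def space_restrict_space)
    then show ?thesis using \<psi>(2) that by (simp add: trace_ketbra)
  qed
  have pa: "p x y \<le> a x" if "x \<in> space M" "y \<in> space N" for x y
    using joint_le[OF that] t[OF that(2)] by simp
  show "AE z in MN. 0 \<le> ent (p (fst z) (snd z)) (a (fst z))"
    by (intro AE_I2 ent_nonneg) (auto simp: space_pair_measure joint_nonneg pa)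
  show "AE z in MN. f z * ln 2 + ent (p (fst z) (snd z)) (a (fst z)) \<le> u z"
    using AE_joint_pos
  proof (rule AE_mp, intro AE_I2 impI)
    fix z assume "z \<in> space MN"
      and *: "p (fst z) (snd z) > 0 \<longrightarrow> a (fst z) > 0 \<and> t (snd z) > 0 \<and> q (snd z) > 0"
    obtain x y where z: "z = (x, y)" by (cases z)
    with \<open>z \<in> space MN\<close> have s: "x \<in> space M" "y \<in> space N" by (auto simp: space_pair_measure)
    show "f z * ln 2 + ent (p (fst z) (snd z)) (a (fst z)) \<le> u z"
    proof (cases "p x y = 0")
      case True
      then show ?thesis by (simp add: z info_term_def u_def ent_def)
    next
      case False
      then have pos: "p x y > 0" "a x > 0" "t y > 0" "q y > 0"
        using * joint_nonneg[OF s] by (auto simp: z)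
      have "info_term M \<rho> P x y * ln 2 + ent (p x y) (a x) = p x y * ln (t y / q y)"
        unfolding info_term_ln2 ent_def
        using pos by (simp add: t[OF s(2)] ln_div ln_mult algebra_simps)
      also have "\<dots> \<le> u (x, y)" using pos by (intro u_upper)
      finally show ?thesis by (simp add: z)
    qed
  qed
  show "ennreal ?h \<le> (\<integral>\<^sup>+z. ennreal (ent (p (fst z) (snd z)) (a (fst z))) \<partial>MN)"
  proof -
    have "ennreal ?h = (\<integral>\<^sup>+x. ennreal ?h * ennreal (a x) \<partial>M)"
      by (simp add: nn_integral_cmult nn_integral_input)
    also have "\<dots> \<le> (\<integral>\<^sup>+x. (\<integral>\<^sup>+y. ennreal (ent (p x y) (a x)) \<partial>N) \<partial>M)"
    proof (rule nn_integral_mono)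
      fix x assume x: "x \<in> space M"
      \<comment> \<open>For a single ket the deficit is known exactly; splitting a state into kets
        can only lower the total deficit, which is the direction needed here.\<close>
      obtain m v where v: "\<rho> x = (\<Sum>k<m::nat. ketbra (v k))"
        using psd_sum_ketbra[OF psd_ensemble[OF x]] .
      let ?p = "\<lambda>k y. Re (trace (ketbra (v k) ** P y))"
      have ax: "a x = (\<Sum>k<m. (norm (v k))\<^sup>2)"
        by (simp add: input_prob_def v trace_sum trace_ketbra)
      have px: "p x y = (\<Sum>k<m. ?p k y)" for y
        unfolding joint_prob_def v
        by (rule linear_sum[OF bounded_linear.linear[OF bounded_linear_trace_mult_left[of "P y"]]])
      have "ennreal ?h * ennreal (a x) = (\<Sum>k<m. ennreal (?h * (norm (v k))\<^sup>2))"
      proof -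
        have "ennreal ?h * ennreal (a x) = ennreal (\<Sum>k<m. ?h * (norm (v k))\<^sup>2)"
          unfolding ax sum_distrib_left[symmetric]
          by (rule ennreal_mult[symmetric]) (simp_all add: harmonic_tail_nonneg sum_nonneg)
        then show ?thesis by (simp add: harmonic_tail_nonneg)
      qed
      also have "\<dots> = (\<Sum>k<m. \<integral>\<^sup>+y. ennreal (ent (?p k y) ((norm (v k))\<^sup>2)) \<partial>N)"
        using scrooge_ent[OF assms] by simp
      also have "\<dots> = (\<integral>\<^sup>+y. (\<Sum>k<m. ennreal (ent (?p k y) ((norm (v k))\<^sup>2))) \<partial>N)"
        by (rule nn_integral_sum[symmetric]) measurable
      also have "\<dots> \<le> (\<integral>\<^sup>+y. ennreal (ent (p x y) (a x)) \<partial>N)"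
      proof (rule nn_integral_mono)
        fix y assume y: "y \<in> space N"
        have k: "0 \<le> ?p k y" "?p k y \<le> (norm (v k))\<^sup>2" for k
          using trace_mult_psd[OF psd_ketbra psd_povm[OF y], of "v k"] t[OF y]
          by (simp_all add: trace_ketbra)
        have "(\<Sum>k<m. ennreal (ent (?p k y) ((norm (v k))\<^sup>2))) = ennreal (\<Sum>k<m. ent (?p k y) ((norm (v k))\<^sup>2))"
          by (rule sum_ennreal) (intro ent_nonneg k)
        also have "\<dots> \<le> ennreal (ent (p x y) (a x))"
          unfolding px ax by (intro ennreal_leI ent_sum_le k) simp
        finally show "(\<Sum>k<m. ennreal (ent (?p k y) ((norm (v k))\<^sup>2))) \<le> ennreal (ent (p x y) (a x))" .
      qed
      finally show "ennreal ?h * ennreal (a x) \<le> (\<integral>\<^sup>+y. ennreal (ent (p x y) (a x)) \<partial>N)" .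
    qed
    also have "\<dots> = (\<integral>\<^sup>+z. ennreal (ent (p (fst z) (snd z)) (a (fst z))) \<partial>MN)"
      by (subst N.nn_integral_fst[symmetric]) simp_all
    finally show ?thesis .
  qed
qed (simp_all add: harmonic_tail_nonneg)

lemma (in ensemble_povm) output_maximally_mixed:
  assumes "average_state M \<rho> = (1 / d) *\<^sub>R mat 1"
  shows "q y = t y / d"
  by (simp add: output_prob_def assms Re_trace_scaleR_mult)

text \<open>
  The ensemble of all signed permutations of a vector \<open>z\<close> has average state \<open>1/d\<close>, so its
  mutual information is \<open>log d\<close> minus an entropy deficit linear in \<open>ent\<close>. Averaging the deficit
  over Gaussian \<open>z\<close> replaces the continuous Haar ensemble by finite ones.
\<close>

lemma signed_perm_ensemble_deficit:
  fixes P :: "real \<Rightarrow> 'n::finite operator" and z :: "complex ^ 'n"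
  assumes povm: "povm N P" and h: "bij_betw h {..<m::nat} signed_perms" and m: "m > 0" and z: "z \<noteq> 0"
    and w: "\<And>M (\<rho> :: real \<Rightarrow> 'n operator). ensemble M \<rho> \<Longrightarrow> mutual_info M \<rho> N P \<le> ereal w"
  shows "ennreal ((ln CARD('n) - w * ln 2) * (real m * (norm z)\<^sup>2)) \<le>
    (\<Sum>k<m. \<integral>\<^sup>+y. ennreal (ent (Re (trace (ketbra (signed_perm (h k) z) ** P y)))
       ((norm z)\<^sup>2 * Re (trace (P y)))) \<partial>N)"
proof -
  \<comment> \<open>Ensembles are indexed by real numbers, so k < m is encoded as
    \<open>real k\<close> and decoded by the floor function. Group elements that yield the same
    vector keep separate indices.\<close>
  define X where "X = real ` {..<m}"
  define V where "V x = signed_perm (h (nat \<lfloor>x\<rfloor>)) z" for x :: real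
  \<comment> \<open>Each of the m vectors has the norm of z, so this normalises the total trace to
    1.\<close>
  define c where "c = 1 / (real m * (norm z)\<^sup>2)"
  have c: "c > 0" using m z by (simp add: c_def)
  define \<rho> where "\<rho> x = c *\<^sub>R ketbra (V x)" for x
  have X: "finite X" by (simp add: X_def)
  have sumX: "(\<Sum>x\<in>X. ketbra (V x)) = (\<Sum>g\<in>signed_perms. ketbra (signed_perm g z))"
    unfolding X_def V_def by (simp add: sum.reindex inj_on_def comp_def)
      (rule sum.reindex_bij_betw[OF h])
  have V: "norm (V x) = norm z" if "x \<in> X" for x
    using that bij_betwE[OF h] by (auto simp: X_def V_def norm_signed_perm)
  have card: "card (signed_perms :: (('n \<Rightarrow> bool) \<times> ('n \<Rightarrow> 'n)) set) = m"
    using bij_betw_same_card[OF h] by simp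
  have avg: "(\<Sum>x\<in>X. \<rho> x) = (1 / real CARD('n)) *\<^sub>R mat 1"
  proof -
    have "(\<Sum>x\<in>X. \<rho> x) = c *\<^sub>R (\<Sum>x\<in>X. ketbra (V x))"
      by (simp add: \<rho>_def scaleR_sum_right)
    also have "\<dots> = c *\<^sub>R (real m * (norm z)\<^sup>2 / real CARD('n)) *\<^sub>R mat 1"
      unfolding sumX signed_perm_frame card ..
    finally show ?thesis using m z by (simp add: c_def)
  qed
  have "(\<Sum>x\<in>X. trace (\<rho> x)) = 1"
    unfolding trace_sum[symmetric] avg
    by (simp add: trace_def mat_def scaleR_conv_of_real[where 'a = complex])
  moreover have "psd (\<rho> x)" for x
    using c by (simp add: \<rho>_def scaleR_ketbra psd_ketbra)
  ultimately have ens: "ensemble (count_space X) \<rho>" and avg': "average_state (count_space X) \<rho> = (1 / real CARD('n)) *\<^sub>R mat 1"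
    using ensemble_count_space[OF X, of \<rho>] avg by auto
  define d where "d = real CARD('n)"
  interpret ensemble_povm "count_space X" N \<rho> P d
    by unfold_locales (rule ens povm d_def)+
  define B where "B x y = Re (trace (ketbra (V x) ** P y))" for x y
  define e where "e x y = ent (B x y) ((norm z)\<^sup>2 * t y)" for x y
  have B: "0 \<le> B x y" "B x y \<le> (norm z)\<^sup>2 * t y" if "x \<in> X" "y \<in> space N" for x y
    using trace_mult_psd[OF psd_ketbra psd_povm[OF that(2)], of "V x"] V[OF that(1)]
    by (simp_all add: B_def trace_ketbra)
  have pB: "p x y = c * B x y" for x y
    by (simp add: Re_trace_scaleR_mult joint_prob_def \<rho>_def B_def)
  have ax: "a x = c * (norm z)\<^sup>2" if "x \<in> X" for x
    using V[OF that]
    by (simp add: Re_trace_scaleR input_prob_def \<rho>_def trace_ketbra)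
  have qy: "q y = t y / d" for y
    using avg' by (intro output_maximally_mixed) (simp add: d)
  have [measurable]: "V \<in> borel_measurable (count_space X)" by simp
  have [measurable]: "(\<lambda>z. e (fst z) (snd z)) \<in> borel_measurable MN"
    unfolding e_def B_def by measurable
  have "ennreal (ln d - w * ln 2) \<le> (\<integral>\<^sup>+z. ennreal (c * e (fst z) (snd z)) \<partial>MN)"
  proof (rule deficit_ge)
    show "mutual_info (count_space X) \<rho> N P \<le> ereal w" by (rule w[OF ens])
    show "AE z in MN. 0 \<le> c * e (fst z) (snd z)"
      unfolding e_def using c B by (intro AE_I2 mult_nonneg_nonneg ent_nonneg) (auto simp: space_pair_measure)
    show "AE z in MN. p (fst z) (snd z) * ln d \<le> f z * ln 2 + c * e (fst z) (snd z)"
    proof (rule AE_I2)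
      fix xy assume "xy \<in> space MN"
      then obtain x y where xy: "xy = (x, y)" and s: "x \<in> X" "y \<in> space N" by (auto simp: space_pair_measure)
      show "p (fst xy) (snd xy) * ln d \<le> f xy * ln 2 + c * e (fst xy) (snd xy)"
      proof (cases "B x y = 0")
        case True
        then show ?thesis by (simp add: xy pB info_term_def e_def ent_def)
      next
        case False
        then have pos: "B x y > 0" "(norm z)\<^sup>2 * t y > 0"
          using B[OF s] by auto
        then have ty: "t y > 0" by (auto simp: zero_less_mult_iff not_less)
        \<comment> \<open>The normalisation c cancels from the ratio, and the average state 1/d
          contributes the factor d.\<close>
        have "p x y / (a x * q y) = B x y * d / ((norm z)\<^sup>2 * t y)"
          using c by (simp add: pB ax[OF s(1)] qy)
        then have "ln (p x y / (a x * q y)) = ln d - ln ((norm z)\<^sup>2 * t y / B x y)"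
          using pos ty z d_ge_1 by (simp add: ln_div ln_mult)
        then show ?thesis
          by (simp add: xy info_term_ln2 e_def ent_def pB right_diff_distrib)
      qed
    qed
  qed measurable
  \<comment> \<open>Multiplying by 1/c undoes the normalisation, so no quotient depending on z is
    left when the bound is integrated over z.\<close>
  then have "ennreal (real m * (norm z)\<^sup>2) * ennreal (ln d - w * ln 2) \<le>
      ennreal (real m * (norm z)\<^sup>2) * (\<integral>\<^sup>+z. ennreal (c * e (fst z) (snd z)) \<partial>MN)"
    by (rule mult_left_mono) simp
  also have "\<dots> = (\<integral>\<^sup>+xy. ennreal (real m * (norm z)\<^sup>2) * ennreal (c * e (fst xy) (snd xy)) \<partial>MN)"
    by (rule nn_integral_cmult[symmetric]) measurable
  also have "\<dots> = (\<integral>\<^sup>+xy. ennreal (e (fst xy) (snd xy)) \<partial>MN)"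
    using m z by (simp add: c_def flip: ennreal_mult')
  also have "\<dots> = (\<integral>\<^sup>+x. (\<integral>\<^sup>+y. ennreal (e x y) \<partial>N) \<partial>count_space X)"
    by (subst N.nn_integral_fst[symmetric]) simp_all
  also have "\<dots> = (\<Sum>k<m. \<integral>\<^sup>+y. ennreal (e (real k) y) \<partial>N)"
    by (simp add: nn_integral_count_space_finite X) (simp add: X_def sum.reindex inj_on_def)
  finally have "ennreal (real m * (norm z)\<^sup>2) * ennreal (ln d - w * ln 2) \<le>
    (\<Sum>k<m. \<integral>\<^sup>+y. ennreal (e (real k) y) \<partial>N)" .
  moreover have "ennreal ((ln d - w * ln 2) * (real m * (norm z)\<^sup>2)) =
      ennreal (real m * (norm z)\<^sup>2) * ennreal (ln d - w * ln 2)"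
    by (subst mult.commute, rule ennreal_mult') simp
  ultimately show ?thesis by (simp add: e_def B_def V_def d)
qed

text \<open>The bound for the signed permutation ensembles holds for every nonzero z; integrating it
  over the Gaussian and exchanging the integrals evaluates the total deficit exactly.\<close>

lemma informational_power_lower:
  fixes P :: "real \<Rightarrow> 'n::finite operator"
  assumes povm: "povm N P" and rank: "rank_one N P"
    and w: "\<And>M (\<rho> :: real \<Rightarrow> 'n operator). ensemble M \<rho> \<Longrightarrow> mutual_info M \<rho> N P \<le> ereal w"
  shows "ln CARD('n) - w * ln 2 \<le> harmonic_tail CARD('n)"
proof -
  let ?G = "signed_perms :: (('n \<Rightarrow> bool) \<times> ('n \<Rightarrow> 'n)) set"
  let ?d = "real CARD('n)" and ?h = "harmonic_tail CARD('n)"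
  define m where "m = card ?G"
  have "(\<lambda>_. False, id) \<in> ?G" by (simp add: signed_perms_def)
  then have m: "m > 0" by (auto simp: m_def card_gt_0_iff)
  obtain h where h: "bij_betw h {..<m} ?G"
    using ex_bij_betw_nat_finite[of ?G] by (auto simp: m_def atLeast0LessThan)
  define b where "b = ln ?d - w * ln 2"
  let ?e = "\<lambda>k z y. ennreal (ent (Re (trace (ketbra (signed_perm (h k) z) ** P y))) ((norm z)\<^sup>2 * Re (trace (P y))))"
  interpret N: sigma_finite_measure N using povm by (simp add: povm_def sigma_finite_index)
  interpret \<gamma>: prob_space "gauss :: (complex ^ 'n) measure" by (rule prob_space_gauss) simp
  interpret pair_sigma_finite "gauss :: (complex ^ 'n) measure" N ..
  have [measurable]: "P \<in> borel_measurable N" using povm by (simp add: povm_def)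
  have P: "psd (P y)" if "y \<in> space N" for y using povm that by (simp add: povm_def effect_def)
  have t: "(\<integral>\<^sup>+y. ennreal (Re (trace (P y))) \<partial>N) = ennreal ?d"
  proof -
    have P': "integrable N P" "integral\<^sup>L N P = mat 1" using povm by (auto simp: povm_def has_bochner_integral_iff)
    have "trace (mat 1 :: 'n operator) = of_nat CARD('n)" by (simp add: trace_def mat_def)
    then show ?thesis
      using integrable_bounded_linear[OF bounded_linear_Re_trace P'(1)]
        integral_bounded_linear[OF bounded_linear_Re_trace P'(1)] trace_psd[OF P] P'(2)
      by (subst nn_integral_eq_integral) auto
  qed
  \<comment> \<open>Rank one of the effects enters here: for a ket the Gaussian average is known
    exactly, whereas by the log sum inequality a mixed effect has a deficit at least as large as
    that of its parts together.\<close>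
  have inner: "(\<integral>\<^sup>+z. ?e k z y \<partial>gauss) = ennreal (?h * Re (trace (P y)))" if k: "k < m" and y: "y \<in> space N" for k y
  proof -
    obtain v where v: "P y = ketbra v"
      using psd_rank_one_ketbra[OF P[OF y]] rank y by (auto simp: rank_one_def)
    have "h k \<in> ?G" using bij_betwE[OF h] k by simp
    then obtain v' where v': "norm v' = norm v" "\<And>z. cinner (signed_perm (h k) z) v = cinner z v'"
      using signed_perm_adjoint[of "h k" v] by blast
    have "?e k z y = ennreal (ent ((cmod (cinner v' z))\<^sup>2) ((norm v')\<^sup>2 * (norm z)\<^sup>2))" for z
      by (simp add: v trace_ketbra_ketbra trace_ketbra v' cmod_cinner_commute[of z] mult.commute)
    then show ?thesis
      using nn_integral_gauss_ent[of v'] by (simp add: v trace_ketbra v')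
  qed
  obtain k where k: "CARD('n) = Suc k" using not0_implies_Suc[of "CARD('n)"] by auto
  have D: "DIM(complex ^ 'n) = 2 * Suc k" by (simp add: k)
  show ?thesis
  \<comment> \<open>A negative b would be truncated by \<open>ennreal\<close>; in that case the
    claim follows from nonnegativity of the harmonic tail.\<close>
  proof (cases "b \<ge> 0")
    case True
    have "ennreal (b * (real m * ?d)) = ennreal (b * real m) * ennreal ?d"
      using True by (simp add: mult.assoc flip: ennreal_mult)
    also have "ennreal ?d = (\<integral>\<^sup>+z. ennreal ((norm z)\<^sup>2) \<partial>(gauss :: (complex ^ 'n) measure))"
      using integral_gauss_norm_sq[OF D] integrable_gauss_norm_sq[OF D]
      by (subst nn_integral_eq_integral) (simp_all add: k)
    also have "ennreal (b * real m) * \<dots> =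
        (\<integral>\<^sup>+z. ennreal (b * real m) * ennreal ((norm z)\<^sup>2) \<partial>(gauss :: (complex ^ 'n) measure))"
      by (rule nn_integral_cmult[symmetric]) measurable
    also have "\<dots> \<le> (\<integral>\<^sup>+z. (\<Sum>k<m. \<integral>\<^sup>+y. ?e k z y \<partial>N) \<partial>gauss)"
    proof (rule nn_integral_mono)
      fix z :: "complex ^ 'n"
      show "ennreal (b * real m) * ennreal ((norm z)\<^sup>2) \<le> (\<Sum>k<m. \<integral>\<^sup>+y. ?e k z y \<partial>N)"
      \<comment> \<open>The vector z = 0 generates no ensemble, but there the left side is
        0.\<close>
      proof (cases "z = 0")
        case False
        have "ennreal (b * real m) * ennreal ((norm z)\<^sup>2) = ennreal (b * (real m * (norm z)\<^sup>2))"
          using True by (simp add: mult.assoc flip: ennreal_mult)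
        also have "\<dots> \<le> (\<Sum>k<m. \<integral>\<^sup>+y. ?e k z y \<partial>N)"
          unfolding b_def by (rule signed_perm_ensemble_deficit[OF povm h m False w])
        finally show ?thesis .
      qed simp
    qed
    also have "\<dots> = (\<Sum>k<m. \<integral>\<^sup>+z. (\<integral>\<^sup>+y. ?e k z y \<partial>N) \<partial>gauss)"
      by (rule nn_integral_sum) measurable
    also have "\<dots> = (\<Sum>k<m. \<integral>\<^sup>+y. (\<integral>\<^sup>+z. ?e k z y \<partial>gauss) \<partial>N)"
      by (intro sum.cong refl Fubini'[symmetric]) measurable
    also have "\<dots> = (\<Sum>k<m. \<integral>\<^sup>+y. ennreal (?h * Re (trace (P y))) \<partial>N)"
      by (intro sum.cong refl nn_integral_cong inner) auto
    also have "\<dots> = ennreal (?h * (real m * ?d))"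
      using m by (simp add: ennreal_mult' harmonic_tail_nonneg nn_integral_cmult t ennreal_of_nat_eq_real_of_nat[symmetric] mult_ac)
    finally have "b * (real m * ?d) \<le> ?h * (real m * ?d)"
      by (subst (asm) ennreal_le_iff) (simp_all add: harmonic_tail_nonneg)
    then show ?thesis using m by (simp add: b_def)
  next
    case False
    then show ?thesis using harmonic_tail_nonneg[of "CARD('n)"] by (simp add: b_def)
  qed
qed

text \<open>One pair serves both claims about the upper bound: the POVM is the witness for the given
  ensemble, and the ensemble is the witness for the given POVM. The outcome determines the
  input.\<close>

lemma mutual_info_orthonormal:
  assumes I: "finite I" "card I = CARD('n)" and e: "orthonormal_basis I (e :: real \<Rightarrow> complex ^ 'n::finite)"
    and \<rho>: "\<And>x. x \<in> I \<Longrightarrow> \<rho> x = (1 / real CARD('n)) *\<^sub>R ketbra (e x)"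
    and P: "\<And>y. y \<in> I \<Longrightarrow> P y = ketbra (e y)"
  shows "ensemble (count_space I) \<rho>" "povm (count_space I) P"
    "ereal (log 2 CARD('n)) \<le> mutual_info (count_space I) \<rho> (count_space I) P"
proof -
  let ?d = "real CARD('n)"
  have res: "(\<Sum>i\<in>I. ketbra (e i)) = mat 1" by (rule orthonormal_basis_resolution[OF I(1) e])
  have avg: "(\<Sum>x\<in>I. \<rho> x) = (1 / ?d) *\<^sub>R mat 1"
    by (simp add: \<rho> scaleR_sum_right[symmetric] res)
  have "(\<Sum>x\<in>I. trace (\<rho> x)) = 1"
    unfolding trace_sum[symmetric] avg
    by (simp add: trace_def mat_def scaleR_conv_of_real[where 'a = complex])
  moreover have "psd (\<rho> x)" if "x \<in> I" for x
    using that by (simp add: \<rho> scaleR_ketbra psd_ketbra)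
  ultimately have ens: "ensemble (count_space I) \<rho>"
    and avg': "average_state (count_space I) \<rho> = (1 / ?d) *\<^sub>R mat 1"
    using ensemble_count_space[OF I(1), of \<rho>] avg by auto
  then show "ensemble (count_space I) \<rho>" by simp
  show povm: "povm (count_space I) P"
    using I(1) res by (intro povm_count_space) (simp_all add: P psd_ketbra)
  define d where "d = ?d"
  interpret ensemble_povm "count_space I" "count_space I" \<rho> P d
    by unfold_locales (rule ens povm d_def)+
  have p: "p x y = (if x = y then 1 / d else 0)" if "x \<in> I" "y \<in> I" for x y
    using e that
    by (simp add: Re_trace_scaleR_mult joint_prob_def \<rho> P d trace_ketbra_ketbra orthonormal_basis_def)
  have a: "a x = 1 / d" if "x \<in> I" for x
    using that
      orthonormal_basis_norm[OF e that]
    by (simp add: input_prob_def \<rho> d trace_ketbra Re_trace_scaleR)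
  have q: "q y = 1 / d" if "y \<in> I" for y
    using output_maximally_mixed[of y] avg' orthonormal_basis_norm[OF e that] that
    by (simp add: d P trace_ketbra)
  \<comment> \<open>Off the diagonal both sides vanish with p; on it the ratio p/(aq) equals
    d.\<close>
  have "p (fst z) (snd z) * ln d \<le> f z * ln 2" if "z \<in> space MN" for z
    using that d_ge_1 by (auto simp: space_pair_measure info_term_ln2 p a q info_term_def log_def)
  \<comment> \<open>There is no loss, so \<open>deficit_ge\<close> applies with g = 0 and with the
    information itself as the bound w.\<close>
  then have "ennreal (ln d - integral\<^sup>L MN f * ln 2) \<le> (\<integral>\<^sup>+z. ennreal 0 \<partial>MN)"
    by (intro deficit_ge) (auto simp: mutual_info_eq)
  then have "ln d \<le> integral\<^sup>L MN f * ln 2" by (simp add: ennreal_eq_0_iff)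
  then show "ereal (log 2 CARD('n)) \<le> mutual_info (count_space I) \<rho> (count_space I) P"
    unfolding mutual_info_eq by (simp add: d log_def field_simps)
qed

theorem theorem1:
  fixes M N :: "real measure" and \<rho> P :: "real \<Rightarrow> complex ^ 'n::finite ^ 'n"
  defines "d \<equiv> CARD('n)"
  assumes "ensemble M \<rho>" and "rank_one M \<rho>"
    and "povm N P" and "rank_one N P"
  shows "0 \<le> accessible_information M \<rho> \<and>
         accessible_information M \<rho> \<le> ereal (log 2 d) \<and>
         ereal (log 2 d - 1 / ln 2 * (\<Sum>n=2..d. 1 / real n)) \<le> informational_power N P \<and>
         informational_power N P \<le> ereal (log 2 d) \<and>
         ((\<forall>x\<in>space M. \<exists>c::real. \<rho> x = c *\<^sub>R average_state M \<rho>) \<longrightarrow>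
            accessible_information M \<rho> = 0) \<and>
         (M = count_space (real ` {1..d}) \<and>
          (\<exists>e. orthonormal_basis (real ` {1..d}) e \<and>
               (\<forall>x\<in>space M. \<rho> x = (1 / real d) *\<^sub>R ketbra (e x))) \<longrightarrow>
            accessible_information M \<rho> = ereal (log 2 d)) \<and>
         (scrooge_povm N P \<longrightarrow>
            informational_power N P = ereal (log 2 d - 1 / ln 2 * (\<Sum>n=2..d. 1 / real n))) \<and>
         (N = count_space (real ` {1..d}) \<and>
          (\<exists>e. orthonormal_basis (real ` {1..d}) e \<and>
               (\<forall>y\<in>space N. P y = ketbra (e y))) \<longrightarrow>
            informational_power N P = ereal (log 2 d))"
proof -
  let ?h = "harmonic_tail CARD('n)"
  let ?L = "log 2 d - 1 / ln 2 * (\<Sum>n=2..d. 1 / real n)"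
  note ens = assms(2) and povm = assms(4)
  have ep: "ensemble_povm M' N' \<rho>' P' (real d)"
    if "ensemble M' \<rho>'" "povm N' P'" for M' N' and \<rho>' P' :: "real \<Rightarrow> 'n operator"
    using that by unfold_locales (simp_all add: d_def)
  have up: "mutual_info M' \<rho>' N' P' \<le> ereal (log 2 d)" and nn: "0 \<le> mutual_info M' \<rho>' N' P'"
    if "ensemble M' \<rho>'" "povm N' P'" for M' N' and \<rho>' P' :: "real \<Rightarrow> 'n operator"
    using ensemble_povm.mutual_info_le[OF ep[OF that]] ensemble_povm.mutual_info_nonneg[OF ep[OF that]]
    by (simp_all add: d_def)
  have A_ge: "mutual_info M \<rho> N' P' \<le> accessible_information M \<rho>" if "povm N' P'" for N' P'
    unfolding accessible_information_def using that by (intro SUP_upper2[of "(N', P')"]) auto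
  have A_le: "accessible_information M \<rho> \<le> c"
    if "\<And>N' P'. povm N' P' \<Longrightarrow> mutual_info M \<rho> N' P' \<le> c" for c
    unfolding accessible_information_def using that by (intro SUP_least) auto
  have W_ge: "mutual_info M' \<rho>' N P \<le> informational_power N P" if "ensemble M' \<rho>'" for M' \<rho>'
    unfolding informational_power_def using that by (intro SUP_upper2[of "(M', \<rho>')"]) auto
  have W_le: "informational_power N P \<le> c"
    if "\<And>M' \<rho>'. ensemble M' \<rho>' \<Longrightarrow> mutual_info M' \<rho>' N P \<le> c" for c
    unfolding informational_power_def using that by (intro SUP_least) auto
  have L: "?L = (ln d - ?h) / ln 2"
    by (simp add: log_def harmonic_tail_def d_def diff_divide_distrib)
  have A0: "0 \<le> accessible_information M \<rho>"
    using nn[OF ens povm] A_ge[OF povm] by (rule order_trans)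
  have A1: "accessible_information M \<rho> \<le> ereal (log 2 d)"
    by (rule A_le) (rule up[OF ens])
  have W1: "informational_power N P \<le> ereal (log 2 d)"
    by (rule W_le) (rule up[OF _ povm])
  have W0: "ereal ?L \<le> informational_power N P"
  proof -
    \<comment> \<open>Lying between 0 and log d, the supremum is a real number w, and it is itself
      the uniform bound that \<open>informational_power_lower\<close> asks for.\<close>
    have "0 \<le> informational_power N P"
      using nn[OF ens povm] W_ge[OF ens] by (rule order_trans)
    with W1 obtain w where w: "informational_power N P = ereal w"
      by (cases "informational_power N P") auto
    have "ln d - w * ln 2 \<le> ?h"
      unfolding d_def using W_ge w by (intro informational_power_lower[OF povm assms(5)]) simp
    then show ?thesis unfolding w L by (simp add: field_simps)
  qed
  have A_prop: "accessible_information M \<rho> = 0"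
    if proportional: "\<forall>x\<in>space M. \<exists>c::real. \<rho> x = c *\<^sub>R average_state M \<rho>"
  proof (rule antisym[OF A_le A0])
    fix N' and P' :: "real \<Rightarrow> 'n operator" assume P': "povm N' P'"
    note E = ep[OF ens P']
    \<comment> \<open>Since the average state has trace 1, the factor c equals a, so p = a q. The
      ratio in the logarithm is then 1, unless p = 0.\<close>
    have "info_term M \<rho> P' x y = 0" if "x \<in> space M" for x y
    proof -
      from bspec[OF proportional that]
      obtain c :: real where c: "\<rho> x = c *\<^sub>R average_state M \<rho>" by (rule exE)
      have "joint_prob \<rho> P' x y = c * output_prob M \<rho> P' y"
        by (simp add: Re_trace_scaleR_mult joint_prob_def output_prob_def c)
      moreover have "input_prob \<rho> x = c"
        by (simp add: Re_trace_scaleR input_prob_def c ensemble_povm.Re_trace_average_state[OF E])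
      ultimately show ?thesis
        by (cases "c * output_prob M \<rho> P' y = 0") (simp_all add: info_term_def)
    qed
    then have "integral\<^sup>L (M \<Otimes>\<^sub>M N') (\<lambda>z. info_term M \<rho> P' (fst z) (snd z)) = 0"
      by (intro integral_eq_zero_AE AE_I2) (auto simp: space_pair_measure)
    then show "mutual_info M \<rho> N' P' \<le> 0" by (simp add: ensemble_povm.mutual_info_eq[OF E])
  qed
  have I: "finite (real ` {1..d})" "card (real ` {1..d}) = CARD('n)"
    by (simp_all add: card_image inj_on_def d_def)
  have A_onb: "accessible_information M \<rho> = ereal (log 2 d)"
    if M: "M = count_space (real ` {1..d})" and e: "orthonormal_basis (real ` {1..d}) e"
      and \<rho>: "\<forall>x\<in>space M. \<rho> x = (1 / real d) *\<^sub>R ketbra (e x)" for e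
  proof (rule antisym[OF A1])
    note onb = mutual_info_orthonormal[OF I e, of \<rho> "\<lambda>y. ketbra (e y)"]
    have \<rho>': "x \<in> real ` {1..d} \<Longrightarrow> \<rho> x = (1 / real CARD('n)) *\<^sub>R ketbra (e x)" for x
      using \<rho> unfolding M d_def space_count_space by blast
    show "ereal (log 2 d) \<le> accessible_information M \<rho>"
      using onb(3)[OF \<rho>' refl] A_ge[OF onb(2)[OF \<rho>' refl]] unfolding M d_def by (rule order_trans)
  qed
  have W_onb: "informational_power N P = ereal (log 2 d)"
    if N: "N = count_space (real ` {1..d})" and e: "orthonormal_basis (real ` {1..d}) e"
      and P: "\<forall>y\<in>space N. P y = ketbra (e y)" for e
  proof (rule antisym[OF W1])
    note onb = mutual_info_orthonormal[OF I e, of "\<lambda>x. (1 / real CARD('n)) *\<^sub>R ketbra (e x)" P]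
    have P': "y \<in> real ` {1..d} \<Longrightarrow> P y = ketbra (e y)" for y
      using P unfolding N space_count_space by blast
    show "ereal (log 2 d) \<le> informational_power N P"
      using onb(3)[OF refl P'] W_ge[OF onb(1)[OF refl P']] unfolding N d_def by (rule order_trans)
  qed
  have W_scrooge: "informational_power N P = ereal ?L" if "scrooge_povm N P"
  proof (rule antisym[OF W_le W0])
    fix M' and \<rho>' :: "real \<Rightarrow> 'n operator" assume "ensemble M' \<rho>'"
    from ensemble_povm.scrooge_mutual_info_le[OF ep[OF this povm] that]
    show "mutual_info M' \<rho>' N P \<le> ereal ?L" unfolding L by (simp add: d_def)
  qed
  show ?thesis
    using A0 A1 W0 W1 A_prop A_onb W_onb W_scrooge by blast
qed

end
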